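(* Let $\mathcal{K}\subset\widehat{\mathbb{C}}=\mathbb{C}\cup\{\infty\}$ be a domain with $\infty\in\mathcal{K}$ whose boundary $\Gamma$ consists of $\ell$ pairwise disjoint closed Jordan curves $\Gamma_1,\ldots,\Gamma_\ell$ with the smooth parametrization $\eta$ on $J$ described in the context. Let $m_1,\ldots,m_\ell$ and $\tau$ be the exponents and the constant of the lemniscatic domain $\mathcal{L}$ corresponding to $\mathcal{K}$ by Walsh's theorem. Fix a point $\alpha_j$ in the interior of $\Gamma_j$ for each $j$, let $\gamma_j(t)=-\log|\eta(t)-\alpha_j|$, $t\in J$, and let $h_j=(h_{1,j},\ldots,h_{\ell,j})$, $j=1,\ldots,\ell$, be the piecewise constant real-valued functions on $J$ associated with $\gamma_j$ as in the context. Then the $\ell+1$ real constants $m_1,\ldots,m_\ell,\log\tau$ are the unique solution of the linear system $$A\begin{bmatrix} m_1 \\ m_2 \\ \vdots \\ m_\ell \\ \log\tau \end{bmatrix}=\begin{bmatrix} 0 \\ 0 \\ \vdots \\ 0 \\ 1 \end{bmatrix},\qquad\text{where}\quad A=\begin{bmatrix} h_{1,1} & h_{1,2} & \cdots & h_{1,\ell} & -1 \\ h_{2,1} & h_{2,2} & \cdots & h_{2,\ell} & -1 \\ \vdots & \vdots & \ddots & \vdots & \vdots \\ h_{\ell,1} & h_{\ell,2} & \cdots & h_{\ell,\ell} & -1 \\ 1 & 1 & \cdots & 1 & 0 \end{bmatrix}.$$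
   Context: Boundary parametrization. $\Gamma$ is oriented so that $\mathcal{K}$ lies to the left of $\Gamma$. Each $\Gamma_j$ is parametrized by a $2\pi$-periodic, twice continuously differentiable complex function $\eta_j(t)$, $t\in J_j=[0,2\pi]$, with $\dot\eta_j(t)\neq0$. $J$ is the disjoint union of $J_1,\ldots,J_\ell$, and $\eta$ on $J$ is defined by $\eta(t)=\eta_j(t)$ for $t\in J_j$. Functions on $\Gamma$ are identified with functions on $J$ via $\eta$. A piecewise constant function $h$ on $J$ is one that is constant on each $J_k$, written $h=(h_1,\ldots,h_\ell)$ with $h(t)=h_k$ for $t\in J_k$; thus $h_j(t)=h_{k,j}$ for $t\in J_k$. Walsh's theorem (known). For $\mathcal{K}$ as in the claim there exist a unique lemniscatic domain $$\mathcal{L}=\Big\{w\in\widehat{\mathbb{C}}:\prod_{j=1}^\ell|w-a_j|^{m_j}>\tau\Big\},$$ with $a_1,\ldots,a_\ell\in\mathbb{C}$ pairwise distinct, $m_1,\ldots,m_\ell,\tau>0$ real and $\sum_{j=1}^\ell m_j=1$, and a unique bijective conformal map $\Phi:\mathcal{K}\to\mathcal{L}$ with $\Phi(z)=z+O(1/z)$ near infinity. $\Phi$ extends to a continuous bijection $\overline{\mathcal{K}}\to\overline{\mathcal{L}}$, and for each $j$ the image $\Phi(\Gamma_j)$ contains $a_j$ in its interior. The functions $\mu_j,h_j,f_j$ (known result). For each $\gamma_j$ there exist a unique real-valued (Hölder continuous) function $\mu_j$ and a unique piecewise constant real-valued function $h_j=(h_{1,j},\ldots,h_{\ell,j})$ on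 $J$ such that $$f_j(\eta(t))=\gamma_j(t)+h_j(t)+\mathrm{i}\mu_j(t),\quad t\in J,$$ are the boundary values of an analytic function $f_j$ in $\mathcal{K}$ with $f_j(\infty)=0$. (With $N(s,t)=\frac1\pi\operatorname{Im}\frac{\dot\eta(t)}{\eta(t)-\eta(s)}$, $M(s,t)=\frac1\pi\operatorname{Re}\frac{\dot\eta(t)}{\eta(t)-\eta(s)}$ and the corresponding integral operators $\mathbf{N}\mu(s)=\int_JN(s,t)\mu(t)\,dt$, $\mathbf{M}\mu(s)=\int_JM(s,t)\mu(t)\,dt$, the latter singular, $\mu_j$ is the unique solution of $(\mathbf{I}-\mathbf{N})\mu_j=-\mathbf{M}\gamma_j$, and $h_j=[\mathbf{M}\mu_j-(\mathbf{I}-\mathbf{N})\gamma_j]/2$.) *)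

theory Defs
  imports "HOL-Analysis.Analysis" "HOL-Library.Landau_Symbols"
begin

section \<open>The extended complex plane\<close>

text \<open>The point at infinity is \<^const>\<open>None\<close>.\<close>

definition riemann_sphere :: "complex option topology" where
  "riemann_sphere = Alexandroff_compactification euclidean"

text \<open>A local parametrization of the sphere around \<open>p\<close> (sending \<open>0\<close> to \<open>p\<close>), and the
  corresponding local coordinate. The value of \<open>sphere_coord p q\<close> is meaningful only for \<open>q\<close>
  near \<open>p\<close>: namely \<open>q \<noteq> None\<close> if \<open>p\<close> is finite, and \<open>q \<noteq> Some 0\<close> if \<open>p\<close> is infinity.\<close>

fun sphere_chart :: "complex option \<Rightarrow> complex \<Rightarrow> complex option" where
  "sphere_chart (Some z) w = Some (z + w)"
| "sphere_chart None w = (if w = 0 then None else Some (inverse w))"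

fun sphere_coord :: "complex option \<Rightarrow> complex option \<Rightarrow> complex" where
  "sphere_coord (Some z) q = the q - z"
| "sphere_coord None q = (case q of None \<Rightarrow> 0 | Some z \<Rightarrow> inverse z)"

definition sphere_analytic_on :: "(complex option \<Rightarrow> complex) \<Rightarrow> complex option set \<Rightarrow> bool" where
  "sphere_analytic_on f K \<longleftrightarrow> (\<forall>p\<in>K. (\<lambda>w. f (sphere_chart p w)) analytic_on {0})"

text \<open>Holomorphic maps into the sphere; continuity keeps the coordinate of the value in its
  meaningful range near each point.\<close>

definition sphere_holomorphic_map ::
    "(complex option \<Rightarrow> complex option) \<Rightarrow> complex option set \<Rightarrow> bool" where
  "sphere_holomorphic_map F K \<longleftrightarrow>
     continuous_map (subtopology riemann_sphere K) riemann_sphere F \<and>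
     (\<forall>p\<in>K. (\<lambda>w. sphere_coord (F p) (F (sphere_chart p w))) analytic_on {0})"

definition conformal_bijection ::
    "(complex option \<Rightarrow> complex option) \<Rightarrow> complex option set \<Rightarrow> complex option set \<Rightarrow> bool" where
  "conformal_bijection F K L \<longleftrightarrow> bij_betw F K L \<and> sphere_holomorphic_map F K"

section \<open>The domain and its parametrized boundary\<close>

definition curve :: "(real \<Rightarrow> complex) \<Rightarrow> complex set" where
  "curve \<eta> = \<eta> ` {0..2*pi}"

text \<open>A \<open>2\<pi>\<close>-periodic, twice continuously differentiable, regular parametrization of a closed
  Jordan curve.\<close>

definition smooth_jordan_param :: "(real \<Rightarrow> complex) \<Rightarrow> bool" where
  "smooth_jordan_param \<eta> \<longleftrightarrow>
     (\<forall>t. \<eta> (t + 2*pi) = \<eta> t) \<and>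
     \<eta> C1_differentiable_on UNIV \<and>
     (\<lambda>t. vector_derivative \<eta> (at t)) C1_differentiable_on UNIV \<and>
     (\<forall>t. vector_derivative \<eta> (at t) \<noteq> 0) \<and>
     inj_on \<eta> {0..<2*pi}"

text \<open>The left normal \<open>\<i> \<eta>'(t)\<close> points into \<open>K\<close>.\<close>

definition lies_left_of :: "complex option set \<Rightarrow> (real \<Rightarrow> complex) \<Rightarrow> bool" where
  "lies_left_of K \<eta> \<longleftrightarrow>
     (\<forall>t. \<forall>\<^sub>F \<epsilon> in at_right 0.
        Some (\<eta> t + of_real \<epsilon> * (\<i> * vector_derivative \<eta> (at t))) \<in> K)"

text \<open>The finite type \<open>'l\<close> indexes the \<open>\<ell> = CARD('l)\<close> boundary curves. A function on the disjoint
  union \<open>J\<close> of the intervals \<open>J\<^sub>k = [0, 2\<pi>]\<close> is a function of the pair \<open>k\<close>, \<open>t\<close>.\<close>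

definition smoothly_bounded_domain ::
    "complex option set \<Rightarrow> ('l::finite \<Rightarrow> real \<Rightarrow> complex) \<Rightarrow> bool" where
  "smoothly_bounded_domain K \<eta> \<longleftrightarrow>
     openin riemann_sphere K \<and> connectedin riemann_sphere K \<and> None \<in> K \<and>
     (\<forall>j. smooth_jordan_param (\<eta> j)) \<and>
     disjoint_family (\<lambda>j. curve (\<eta> j)) \<and>
     riemann_sphere frontier_of K = Some ` (\<Union>j. curve (\<eta> j)) \<and>
     (\<forall>j. lies_left_of K (\<eta> j))"

section \<open>Walsh's conformal map onto a lemniscatic domain\<close>

definition lemniscatic_domain ::
    "('l::finite \<Rightarrow> complex) \<Rightarrow> ('l \<Rightarrow> real) \<Rightarrow> real \<Rightarrow> complex option set" where
  "lemniscatic_domain a m \<tau> =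
     insert None (Some ` {w. (\<Prod>j\<in>UNIV. cmod (w - a j) powr m j) > \<tau>})"

text \<open>\<open>\<Phi>\<close> stands for the conformal map together with its continuous extension to the closure of
  \<open>K\<close>. The last clause fixes which centre \<open>a\<^sub>j\<close> and exponent \<open>m\<^sub>j\<close> belong to which boundary curve.\<close>

definition walsh_map ::
    "complex option set \<Rightarrow> ('l::finite \<Rightarrow> real \<Rightarrow> complex) \<Rightarrow> ('l \<Rightarrow> complex) \<Rightarrow> ('l \<Rightarrow> real) \<Rightarrow> real
      \<Rightarrow> (complex option \<Rightarrow> complex option) \<Rightarrow> bool" where
  "walsh_map K \<eta> a m \<tau> \<Phi> \<longleftrightarrow>
     inj a \<and> (\<forall>j. m j > 0) \<and> \<tau> > 0 \<and> (\<Sum>j\<in>UNIV. m j) = 1 \<and>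
     conformal_bijection \<Phi> K (lemniscatic_domain a m \<tau>) \<and>
     \<Phi> None = None \<and> (\<lambda>z. the (\<Phi> (Some z)) - z) \<in> O[at_infinity](\<lambda>z. 1 / z) \<and>
     continuous_map (subtopology riemann_sphere (riemann_sphere closure_of K)) riemann_sphere \<Phi> \<and>
     bij_betw \<Phi> (riemann_sphere closure_of K)
       (riemann_sphere closure_of lemniscatic_domain a m \<tau>) \<and>
     (\<forall>j. a j \<in> inside {w. Some w \<in> \<Phi> ` Some ` curve (\<eta> j)})"

section \<open>The piecewise constant function associated with boundary data\<close>

definition hoelder_continuous_on :: "real set \<Rightarrow> (real \<Rightarrow> real) \<Rightarrow> bool" where
  "hoelder_continuous_on S u \<longleftrightarrow>
     (\<exists>C \<beta>. 0 < \<beta> \<and> \<beta> \<le> 1 \<and> (\<forall>s\<in>S. \<forall>t\<in>S. \<bar>u s - u t\<bar> \<le> C * \<bar>s - t\<bar> powr \<beta>))"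

text \<open>\<open>\<gamma> + h + \<i> \<mu>\<close> are the boundary values of a function \<open>f\<close> analytic in \<open>K\<close> and vanishing at
  infinity.\<close>

definition associated_functions ::
    "complex option set \<Rightarrow> ('l::finite \<Rightarrow> real \<Rightarrow> complex) \<Rightarrow> ('l \<Rightarrow> real \<Rightarrow> real)
      \<Rightarrow> ('l \<Rightarrow> real \<Rightarrow> real) \<Rightarrow> ('l \<Rightarrow> real) \<Rightarrow> (complex option \<Rightarrow> complex) \<Rightarrow> bool" where
  "associated_functions K \<eta> \<gamma> \<mu> h f \<longleftrightarrow>
     (\<forall>k. hoelder_continuous_on {0..2*pi} (\<mu> k)) \<and>
     sphere_analytic_on f K \<and> f None = 0 \<and>
     (\<forall>k. \<forall>t\<in>{0..2*pi}.
        ((\<lambda>z. f (Some z)) \<longlongrightarrow> complex_of_real (\<gamma> k t + h k) + \<i> * complex_of_real (\<mu> k t))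
          (at (\<eta> k t) within {z. Some z \<in> K}))"

section \<open>The linear system\<close>

text \<open>Rows and columns are indexed by \<open>'l option\<close>, where \<^const>\<open>None\<close> is the last index
  \<open>\<ell> + 1\<close>.\<close>

definition system_matrix :: "('l::finite \<Rightarrow> 'l \<Rightarrow> real) \<Rightarrow> real ^ ('l option) ^ ('l option)" where
  "system_matrix h = (\<chi> r c. case (r, c) of
       (Some k, Some j) \<Rightarrow> h k j
     | (Some k, None) \<Rightarrow> -1
     | (None, Some j) \<Rightarrow> 1
     | (None, None) \<Rightarrow> 0)"

definition append_last :: "('l::finite \<Rightarrow> real) \<Rightarrow> real \<Rightarrow> real ^ ('l option)" where
  "append_last u c = (\<chi> r. case r of Some k \<Rightarrow> u k | None \<Rightarrow> c)"

end

theory Submission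
  imports Defs "HOL-Complex_Analysis.Complex_Analysis"
begin

text \<open>Suppose that \<open>\<Sum>\<^sub>j n\<^sub>j = s\<close> and \<open>\<Sum>\<^sub>j h\<^sub>k\<^sub>j n\<^sub>j = c\<close> for all \<open>k\<close>. The function
  \<open>U = s \<Sum>\<^sub>j m\<^sub>j ln |\<Phi> - a\<^sub>j| - \<Sum>\<^sub>j n\<^sub>j (Re f\<^sub>j + ln |z - \<alpha>\<^sub>j|)\<close> is harmonic on \<open>K\<close>, infinity included:
  the two logarithmic poles cancel and \<open>U\<close> vanishes there. Its boundary value is the constant
  \<open>s ln \<tau> - c\<close>, so the maximum principle gives \<open>U = 0\<close> and \<open>c = s ln \<tau>\<close>. Differentiating \<open>U = 0\<close>
  and integrating along a copy of the boundary curve \<open>i\<close> pushed into \<open>K\<close> compares winding numbers,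
  which by the Jordan curve theorem are \<open>\<plusminus>1\<close> around \<open>a\<^sub>i\<close> and \<open>\<alpha>\<^sub>i\<close> and \<open>0\<close> around the other points;
  hence \<open>n\<^sub>i = \<plusminus>s m\<^sub>i\<close>. For \<open>s = 0\<close> this says that the matrix is injective, so a solution exists. For
  \<open>s = 1\<close> the signs are all positive, because both the \<open>n\<^sub>i\<close> and the positive \<open>m\<^sub>i\<close> sum to \<open>1\<close>; so
  orientations never have to be determined.\<close>

section \<open>Topology of the Riemann sphere\<close>

lemma topspace_riemann_sphere [simp]: "topspace riemann_sphere = UNIV"
  by (auto simp: riemann_sphere_def) (metis not_None_eq rangeI)

lemma compact_space_riemann_sphere: "compact_space riemann_sphere"
  by (simp add: riemann_sphere_def)

lemma openin_riemann_sphere_Some: "openin riemann_sphere (Some ` S) \<longleftrightarrow> open S"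
  by (simp add: riemann_sphere_def)

lemma openin_riemann_sphere_complement:
  "compact C \<Longrightarrow> openin riemann_sphere (insert None (Some ` (- C)))"
  by (auto simp: riemann_sphere_def openin_Alexandroff_compactification Compl_eq_Diff_UNIV
      compact_imp_closed)

lemma open_finite_part:
  assumes "openin riemann_sphere S" shows "open {z. Some z \<in> S}"
proof -
  have "openin euclidean {z \<in> topspace euclidean. Some z \<in> S}"
    using assms continuous_map_Some[of euclidean]
    unfolding riemann_sphere_def by (rule openin_continuous_map_preimage[rotated])
  then show ?thesis by simp
qed

lemma sphere_chart_zero [simp]: "sphere_chart p 0 = p"
  by (cases p) auto

text \<open>Small discs around 0 in the chart are neighbourhoods of the point on the sphere, so a
  local statement in w becomes a topological one. The converse passage is
  \<open>eventually_chart_in_open\<close>.\<close>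

lemma open_nbhd_of_eventually_chart:
  assumes "\<forall>\<^sub>F w in nhds 0. P (sphere_chart p w)"
  shows "\<exists>N. openin riemann_sphere N \<and> p \<in> N \<and> (\<forall>q\<in>N. P q)"
proof -
  obtain d where d: "d > 0" "\<And>w. cmod w < d \<Longrightarrow> P (sphere_chart p w)"
    using assms by (auto simp: eventually_nhds_metric dist_norm)
  show ?thesis
  proof (cases p)
    case (Some z)
    have "P q" if "q \<in> Some ` ball z d" for q
    proof -
      obtain y where "q = Some y" "cmod (y - z) < d"
        using \<open>q \<in> Some ` ball z d\<close> by (auto simp: dist_norm norm_minus_commute)
      then show ?thesis using d(2)[of "y - z"] Some by simp
    qed
    then show ?thesis
      using Some d(1) openin_riemann_sphere_Some[of "ball z d"] by (intro exI[of _ "Some ` ball z d"]) auto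
  next
    case None
    \<comment> \<open>Inversion turns 0 < |w| < d into |y| > 1/d, and w = 0 is infinity
      itself.\<close>
    let ?N = "insert None (Some ` (- cball 0 (1/d)))"
    have "P q" if "q \<in> ?N" for q
    proof (cases q)
      case None
      then show ?thesis using d(2)[of 0] d(1) \<open>p = None\<close> by simp
    next
      case (Some y)
      then have y: "cmod y > 1 / d" using that by auto
      then have "y \<noteq> 0" using d(1) by (auto simp: not_less)
      moreover have "cmod (inverse y) < d"
        using y d(1) \<open>y \<noteq> 0\<close> by (simp add: norm_inverse inverse_eq_divide field_simps norm_divide)
      ultimately show ?thesis using d(2)[of "inverse y"] Some \<open>p = None\<close> by simp
    qed
    then show ?thesis
      using None openin_riemann_sphere_complement[OF compact_cball, of 0 "1/d"] by blast
  qed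
qed

lemma eventually_chart_in_open:
  assumes "openin riemann_sphere N" "p \<in> N"
  shows "\<forall>\<^sub>F w in nhds 0. sphere_chart p w \<in> N"
proof (cases p)
  case (Some z)
  have "open ((\<lambda>w. z + w) -` {z. Some z \<in> N})"
    using open_finite_part[OF assms(1)] by (intro open_vimage continuous_intros)
  then have "\<forall>\<^sub>F w in nhds 0. w \<in> (\<lambda>w. z + w) -` {z. Some z \<in> N}"
    using assms(2) Some by (intro eventually_nhds_in_open) auto
  then show ?thesis by (simp add: Some)
next
  case None
  then obtain C where C: "compact C" "N = insert None (Some ` (- C))"
    using assms unfolding riemann_sphere_def openin_Alexandroff_compactification
    by (auto simp: Compl_eq_Diff_UNIV)
  \<comment> \<open>If 0 < |w| < 1/R, then 1/w has modulus above R and so lies outside the compact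
    set C.\<close>
  obtain R where R: "R > 0" "\<And>z. z \<in> C \<Longrightarrow> cmod z \<le> R"
    using compact_imp_bounded[OF C(1)] by (auto simp: bounded_pos)
  have "sphere_chart p w \<in> N" if "cmod w < 1 / R" for w
  proof (cases "w = 0")
    case True
    then show ?thesis using assms by simp
  next
    case False
    then have "cmod (inverse w) > R" using that R(1) by (simp add: norm_divide inverse_eq_divide field_simps)
    then have "inverse w \<notin> C" using R(2) by force
    then show ?thesis using False None C(2) by simp
  qed
  then show ?thesis using R(1) by (auto simp: eventually_nhds_metric dist_norm intro!: exI[of _ "1/R"])
qed

text \<open>Planar open sets are open on the sphere, so where F takes finite values its continuity
  as a map into the sphere is ordinary continuity.\<close>

lemma continuous_map_finite_part:
  assumes cont: "continuous_map (subtopology riemann_sphere S) riemann_sphere F"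
    and fin: "\<And>z. z \<in> T \<Longrightarrow> Some z \<in> S \<and> F (Some z) \<noteq> None"
  shows "continuous_on T (\<lambda>z. the (F (Some z)))"
  unfolding continuous_on_open_invariant
proof (intro allI impI)
  fix B :: "complex set" assume "open B"
  then have "openin (subtopology riemann_sphere S)
      {q \<in> topspace (subtopology riemann_sphere S). F q \<in> Some ` B}"
    by (intro openin_continuous_map_preimage[OF cont]) (simp add: openin_riemann_sphere_Some)
  then obtain V where V: "openin riemann_sphere V" "{q \<in> S. F q \<in> Some ` B} = V \<inter> S"
    by (auto simp: openin_subtopology)
  have "{z. Some z \<in> V} \<inter> T = (\<lambda>z. the (F (Some z))) -` B \<inter> T"
  proof (intro set_eqI)
    fix z
    have "Some z \<in> V \<longleftrightarrow> the (F (Some z)) \<in> B" if "z \<in> T"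
    proof -
      have "Some z \<in> V \<longleftrightarrow> F (Some z) \<in> Some ` B" using V(2) fin[OF that] by blast
      also have "\<dots> \<longleftrightarrow> the (F (Some z)) \<in> B" using fin[OF that] by force
      finally show ?thesis .
    qed
    then show "z \<in> {z. Some z \<in> V} \<inter> T \<longleftrightarrow> z \<in> (\<lambda>z. the (F (Some z))) -` B \<inter> T" by auto
  qed
  then show "\<exists>A. open A \<and> A \<inter> T = (\<lambda>z. the (F (Some z))) -` B \<inter> T"
    using open_finite_part[OF V(1)] by blast
qed

section \<open>Harmonic germs and the maximum principle on the sphere\<close>

text \<open>Harmonicity near \<open>0\<close>, encoded as being locally the real part of an analytic function.\<close>

definition harmonic_germ :: "(complex \<Rightarrow> real) \<Rightarrow> bool" where
  "harmonic_germ u \<longleftrightarrow> (\<exists>W. W analytic_on {0} \<and> (\<forall>\<^sub>F w in nhds 0. u w = Re (W w)))"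

lemma harmonic_germ_cong:
  assumes "harmonic_germ u" "\<forall>\<^sub>F w in nhds 0. v w = u w"
  shows "harmonic_germ v"
proof -
  obtain W where W: "W analytic_on {0}" "\<forall>\<^sub>F w in nhds 0. u w = Re (W w)"
    using assms(1) by (auto simp: harmonic_germ_def)
  have "\<forall>\<^sub>F w in nhds 0. v w = Re (W w)" using W(2) assms(2) by eventually_elim simp
  then show ?thesis using W(1) by (auto simp: harmonic_germ_def)
qed

lemma harmonic_germ_Re: "W analytic_on {0} \<Longrightarrow> harmonic_germ (\<lambda>w. Re (W w))"
  by (auto simp: harmonic_germ_def)

lemma harmonic_germ_add:
  assumes "harmonic_germ u" "harmonic_germ v" shows "harmonic_germ (\<lambda>w. u w + v w)"
proof -
  obtain U V where U: "U analytic_on {0}" "\<forall>\<^sub>F w in nhds 0. u w = Re (U w)"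
    and V: "V analytic_on {0}" "\<forall>\<^sub>F w in nhds 0. v w = Re (V w)"
    using assms by (auto simp: harmonic_germ_def)
  have "\<forall>\<^sub>F w in nhds 0. u w + v w = Re (U w + V w)" using U(2) V(2) by eventually_elim simp
  moreover have "(\<lambda>w. U w + V w) analytic_on {0}" using U(1) V(1) by (rule analytic_on_add)
  ultimately show ?thesis unfolding harmonic_germ_def by (intro exI[of _ "\<lambda>w. U w + V w"]) auto
qed

lemma harmonic_germ_cmult:
  assumes "harmonic_germ u" shows "harmonic_germ (\<lambda>w. c * u w)"
proof -
  obtain U where U: "U analytic_on {0}" "\<forall>\<^sub>F w in nhds 0. u w = Re (U w)"
    using assms by (auto simp: harmonic_germ_def)
  have "\<forall>\<^sub>F w in nhds 0. c * u w = Re (of_real c * U w)" using U(2) by eventually_elim simp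
  moreover have "(\<lambda>w. of_real c * U w) analytic_on {0}" using U(1) by (intro analytic_intros)
  ultimately show ?thesis unfolding harmonic_germ_def by (intro exI[of _ "\<lambda>w. of_real c * U w"]) auto
qed

lemma harmonic_germ_diff:
  "harmonic_germ u \<Longrightarrow> harmonic_germ v \<Longrightarrow> harmonic_germ (\<lambda>w. u w - v w)"
  using harmonic_germ_add[OF _ harmonic_germ_cmult[of v "-1"]] by simp

lemma harmonic_germ_sum:
  "finite I \<Longrightarrow> (\<And>j. j \<in> I \<Longrightarrow> harmonic_germ (u j)) \<Longrightarrow> harmonic_germ (\<lambda>w. \<Sum>j\<in>I. u j w)"
proof (induction I rule: finite_induct)
  case empty
  show ?case using harmonic_germ_Re[of "\<lambda>_. 0"] by simp
next
  case (insert j I)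
  then show ?case by (simp add: harmonic_germ_add)
qed

text \<open>The quotient g w / g 0 equals 1 at 0, so the principal logarithm is analytic there
  whatever the argument of g 0; the real constant ln |g 0| is added back.\<close>

lemma harmonic_germ_ln_cmod:
  assumes g: "g analytic_on {0}" and "g 0 \<noteq> 0"
  shows "harmonic_germ (\<lambda>w. ln (cmod (g w)))"
proof -
  let ?W = "\<lambda>w. Ln (g w / g 0) + of_real (ln (cmod (g 0)))"
  have "?W analytic_on {0}"
    using assms by (intro analytic_intros) auto
  moreover have "isCont g 0" using g analytic_at_imp_isCont by blast
  then have "\<forall>\<^sub>F w in nhds 0. g w \<noteq> 0"
    using assms(2) by (simp add: isCont_def tendsto_imp_eventually_ne eventually_nhds_conv_at)
  then have "\<forall>\<^sub>F w in nhds 0. ln (cmod (g w)) = Re (?W w)"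
    by eventually_elim (use assms(2) in \<open>simp add: norm_divide ln_div\<close>)
  ultimately show ?thesis unfolding harmonic_germ_def by (intro exI[of _ ?W]) auto
qed

lemma harmonic_germ_tendsto:
  assumes "harmonic_germ u" shows "(u \<longlongrightarrow> u 0) (nhds 0)"
proof -
  obtain W where W: "W analytic_on {0}" "\<forall>\<^sub>F w in nhds 0. u w = Re (W w)"
    using assms by (auto simp: harmonic_germ_def)
  have "u 0 = Re (W 0)" using W(2) eventually_nhds_x_imp_x by blast
  have "isCont W 0" using W(1) analytic_at_imp_isCont by blast
  then have "((\<lambda>w. Re (W w)) \<longlongrightarrow> Re (W 0)) (nhds 0)"
    by (intro tendsto_intros) (simp add: isCont_def tendsto_at_iff_tendsto_nhds)
  then show ?thesis unfolding \<open>u 0 = Re (W 0)\<close>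
    by (rule Lim_transform_eventually) (use W(2) in \<open>simp add: eq_commute\<close>)
qed

text \<open>Since |exp W| = exp (Re W), a local maximum of u is one of |exp W|. The maximum modulus
  principle makes exp W constant near 0, and with it Re W.\<close>

lemma harmonic_germ_local_max:
  assumes "harmonic_germ u" and max: "\<forall>\<^sub>F w in nhds 0. u w \<le> u 0"
  shows "\<forall>\<^sub>F w in nhds 0. u w = u 0"
proof -
  obtain W where W: "W analytic_on {0}" "\<forall>\<^sub>F w in nhds 0. u w = Re (W w)"
    using assms by (auto simp: harmonic_germ_def)
  obtain d1 where d1: "d1 > 0" "W holomorphic_on ball 0 d1"
    using W(1) by (auto simp: analytic_on_def)
  obtain d2 where d2: "d2 > 0" "\<And>w. cmod w < d2 \<Longrightarrow> u w = Re (W w) \<and> u w \<le> u 0"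
    using eventually_conj[OF W(2) max] by (auto simp: eventually_nhds_metric dist_norm)
  define B where "B = ball (0::complex) (min d1 d2)"
  have "(\<lambda>w. exp (W w)) constant_on B"
  proof (rule maximum_modulus_principle[where U = B and \<xi> = 0])
    show "(\<lambda>w. exp (W w)) holomorphic_on B"
      using d1(2) unfolding B_def
      by (intro holomorphic_intros) (auto elim: holomorphic_on_subset)
    show "cmod (exp (W z)) \<le> cmod (exp (W 0))" if "z \<in> B" for z
      using d2(2)[of z] d2(2)[of 0] d2(1) that by (simp add: B_def)
  qed (auto simp: B_def d1 d2)
  then obtain c where c: "\<And>w. w \<in> B \<Longrightarrow> exp (W w) = c" by (auto simp: constant_on_def)
  have "u w = u 0" if "w \<in> B" for w
  proof -
    have "exp (Re (W w)) = exp (Re (W 0))"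
      using c[OF that] c[of 0] d1(1) d2(1) by (metis norm_exp_eq_Re B_def centre_in_ball min_less_iff_conj)
    then show ?thesis using that d2(2)[of w] d2(2)[of 0] d2(1) by (simp add: B_def)
  qed
  moreover have "\<forall>\<^sub>F w in nhds 0. w \<in> B"
    using d1(1) d2(1) unfolding B_def by (intro eventually_nhds_in_open) auto
  ultimately show ?thesis by (auto elim: eventually_mono)
qed

text \<open>If some value exceeded b, the points with at least that value would form a compact
  subset of K, since near the frontier U is close to b. The maximum attained there is taken on an
  open and closed subset of K, so U is constant and above b, against its boundary behaviour.\<close>

lemma sphere_harmonic_le_boundary:
  fixes U :: "complex option \<Rightarrow> real"
  assumes K: "openin riemann_sphere K" "connectedin riemann_sphere K"
    and fr: "riemann_sphere frontier_of K \<noteq> {}"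
    and harm: "\<And>p. p \<in> K \<Longrightarrow> harmonic_germ (\<lambda>w. U (sphere_chart p w))"
    and bd: "\<And>p e. p \<in> riemann_sphere frontier_of K \<Longrightarrow> e > 0 \<Longrightarrow>
        \<exists>N. openin riemann_sphere N \<and> p \<in> N \<and> (\<forall>q\<in>N \<inter> K. \<bar>U q - b\<bar> < e)"
    and "p0 \<in> K"
  shows "U p0 \<le> b"
proof (rule ccontr)
  let ?X = "riemann_sphere"
  assume "\<not> U p0 \<le> b"
  then have gt: "U p0 > b" by simp
  have nbhd: "\<exists>N. openin ?X N \<and> p \<in> N \<and> N \<subseteq> K \<and> (\<forall>q\<in>N. \<bar>U q - U p\<bar> < e)"
    if "p \<in> K" "e > 0" for p e
  proof -
    have "\<forall>\<^sub>F w in nhds 0. \<bar>U (sphere_chart p w) - U p\<bar> < e"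
      using tendstoD[OF harmonic_germ_tendsto[OF harm[OF that(1)]] that(2)] by (simp add: dist_real_def)
    from open_nbhd_of_eventually_chart[OF this] obtain N
      where "openin ?X N" "p \<in> N" "\<forall>q\<in>N. \<bar>U q - U p\<bar> < e" by auto
    then show ?thesis using K(1) that(1) by (intro exI[of _ "N \<inter> K"]) auto
  qed
  have cont: "continuous_map (subtopology ?X K) euclideanreal U"
    unfolding continuous_map_def
  proof (intro conjI allI impI)
    fix V :: "real set" assume "openin euclideanreal V"
    then have "open V" by simp
    have "openin ?X {q \<in> K. U q \<in> V}"
    proof (subst openin_subopen, safe)
      fix p assume "p \<in> K" "U p \<in> V"
      then obtain e where "e > 0" "ball (U p) e \<subseteq> V" using \<open>open V\<close> openE by blast
      with nbhd[OF \<open>p \<in> K\<close> \<open>e > 0\<close>] show "\<exists>T. openin ?X T \<and> p \<in> T \<and> T \<subseteq> {q \<in> K. U q \<in> V}"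
        by (fastforce simp: dist_real_def abs_minus_commute)
    qed
    then show "openin (subtopology ?X K) {x \<in> topspace (subtopology ?X K). U x \<in> V}"
      by (simp add: openin_open_subtopology[OF K(1)])
  qed auto
  define T where "T = {q \<in> K. U q \<ge> U p0}"
  have "closedin ?X T"
    unfolding closedin_def
  proof (intro conjI)
    show "openin ?X (topspace ?X - T)"
    \<comment> \<open>A point outside T has a neighbourhood missing T: by continuity inside K, by
      the boundary value b < U p0 on the frontier, and trivially off the closure of K.\<close>
    proof (subst openin_subopen, safe)
      fix p assume "p \<notin> T"
      consider "p \<in> K" | "p \<in> ?X frontier_of K" | "p \<notin> ?X closure_of K"
        using K(1) by (auto simp: frontier_of_def interior_of_openin)
      then show "\<exists>N. openin ?X N \<and> p \<in> N \<and> N \<subseteq> topspace ?X - T"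
      proof cases
        case 1
        then have "U p < U p0" using \<open>p \<notin> T\<close> by (auto simp: T_def)
        then show ?thesis using nbhd[OF 1, of "U p0 - U p"] by (fastforce simp: T_def)
      next
        case 2
        obtain N where N: "openin ?X N" "p \<in> N" "\<forall>q\<in>N \<inter> K. \<bar>U q - b\<bar> < U p0 - b"
          using bd[OF 2, of "U p0 - b"] gt by auto
        have "U q < U p0" if "q \<in> N" "q \<in> K" for q
          using bspec[OF N(3), of q] that by simp
        then have "N \<subseteq> topspace ?X - T" by (force simp: T_def)
        then show ?thesis using N by blast
      next
        case 3
        then have "p \<in> topspace ?X - ?X closure_of K" by simp
        moreover have "openin ?X (topspace ?X - ?X closure_of K)"
          by (metis closedin_closure_of closedin_def)
        moreover have "T \<subseteq> ?X closure_of K"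
          using closure_of_subset[of K ?X] by (auto simp: T_def)
        ultimately show ?thesis by blast
      qed
    qed
  qed simp
  then have "compactin ?X T" using compact_space_riemann_sphere closedin_compact_space by blast
  then have "compactin (subtopology ?X K) T" by (auto simp: compactin_subtopology T_def)
  then have "compact (U ` T)" using image_compactin[OF _ cont] by fastforce
  moreover have "p0 \<in> T" using \<open>p0 \<in> K\<close> by (simp add: T_def)
  ultimately obtain p1 where p1: "p1 \<in> T" "\<And>q. q \<in> T \<Longrightarrow> U q \<le> U p1"
    using compact_attains_sup[of "U ` T"] by blast
  have p1K: "p1 \<in> K" using p1 by (simp add: T_def)
  have max: "U q \<le> U p1" if "q \<in> K" for q
    using that p1(2)[of q] p1(2)[of p0] \<open>p0 \<in> T\<close> by (force simp: T_def)
  \<comment> \<open>Every point of the maximum set is a local maximum, hence U is constant around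
    it.\<close>
  have "openin (subtopology ?X K) {q \<in> K. U q = U p1}"
    unfolding openin_open_subtopology[OF K(1)]
  proof (intro conjI, subst openin_subopen, safe)
    fix p assume p: "p \<in> K" "U p = U p1"
    have "\<forall>\<^sub>F w in nhds 0. U (sphere_chart p w) = U (sphere_chart p 0)"
    proof (rule harmonic_germ_local_max[OF harm[OF p(1)]])
      show "\<forall>\<^sub>F w in nhds 0. U (sphere_chart p w) \<le> U (sphere_chart p 0)"
        using eventually_chart_in_open[OF K(1) p(1)] by eventually_elim (simp add: max p(2))
    qed
    then have "\<forall>\<^sub>F w in nhds 0. U (sphere_chart p w) = U p1" by (simp add: p(2))
    from open_nbhd_of_eventually_chart[OF this] obtain N
      where N: "openin ?X N" "p \<in> N" "\<forall>q\<in>N. U q = U p1" by auto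
    then show "\<exists>N. openin ?X N \<and> p \<in> N \<and> N \<subseteq> {q \<in> K. U q = U p1}"
      using K(1) p(1) by (intro exI[of _ "N \<inter> K"]) auto
  qed
  moreover have "closedin (subtopology ?X K) {q \<in> K. U q = U p1}"
    using closedin_continuous_map_preimage[OF cont, of "{U p1}"] by simp
  ultimately have "{q \<in> K. U q = U p1} = K"
    using K(2) p1K unfolding connectedin_def connected_space_clopen_in by fastforce
  then have const: "U q = U p1" if "q \<in> K" for q using that by blast
  obtain p where p: "p \<in> ?X frontier_of K" using fr by blast
  obtain N where N: "openin ?X N" "p \<in> N" "\<forall>q\<in>N \<inter> K. \<bar>U q - b\<bar> < U p0 - b"
    using bd[OF p, of "U p0 - b"] gt by auto
  \<comment> \<open>K has points arbitrarily close to the frontier point p, where U is below U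
    p0.\<close>
  have "p \<in> ?X closure_of K" using p by (simp add: frontier_of_def)
  then obtain q where "q \<in> K" "q \<in> N" using N by (auto simp: in_closure_of)
  then show False using N(3) const[of q] const[of p0] \<open>p0 \<in> K\<close> by force
qed

section \<open>Smooth Jordan curves\<close>

abbreviation tangent :: "(real \<Rightarrow> complex) \<Rightarrow> real \<Rightarrow> complex" where
  "tangent \<eta> t \<equiv> vector_derivative \<eta> (at t)"

text \<open>The window starts at an arbitrary c because later both [0, 2 pi) and a window centred at
  a given parameter are used.\<close>

lemma reduce_mod_2pi: "\<exists>n::int. c \<le> x + 2 * pi * of_int n \<and> x + 2 * pi * of_int n < c + 2 * pi"
proof -
  let ?k = "\<lfloor>(x - c) / (2 * pi)\<rfloor>"
  have "of_int ?k \<le> (x - c) / (2 * pi)" "(x - c) / (2 * pi) < of_int ?k + 1" by linarith+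
  then have "of_int ?k * (2 * pi) \<le> x - c" "x - c < (of_int ?k + 1) * (2 * pi)"
    using pos_le_divide_eq[of "2 * pi" "of_int ?k" "x - c"]
      pos_divide_less_eq[of "2 * pi" "x - c" "of_int ?k + 1"] by simp_all
  then show ?thesis by (intro exI[of _ "- ?k"]) (simp add: algebra_simps)
qed

context
  fixes \<eta> :: "real \<Rightarrow> complex"
  assumes sj: "smooth_jordan_param \<eta>"
begin

lemma smooth_jordan_has_vector_derivative: "(\<eta> has_vector_derivative tangent \<eta> t) (at t)"
  using sj by (auto simp: smooth_jordan_param_def C1_differentiable_on_eq vector_derivative_works)

lemma smooth_jordan_continuous: "continuous_on S \<eta>"
  by (intro continuous_at_imp_continuous_on ballI
      has_vector_derivative_continuous[OF smooth_jordan_has_vector_derivative])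

lemma smooth_jordan_continuous_deriv: "continuous_on S (tangent \<eta>)"
  using sj by (auto simp: smooth_jordan_param_def C1_differentiable_on_eq intro: continuous_on_subset)

lemma smooth_jordan_deriv_nonzero: "tangent \<eta> t \<noteq> 0"
  using sj by (simp add: smooth_jordan_param_def)

lemma smooth_jordan_periodic: "\<eta> (t + 2 * pi * of_int n) = \<eta> t"
proof -
  have nat: "\<eta> (t + 2 * pi * of_nat k) = \<eta> t" for k t
  proof (induction k)
    case (Suc k)
    have "\<eta> (t + 2 * pi * of_nat (Suc k)) = \<eta> ((t + 2 * pi * of_nat k) + 2 * pi)"
      by (simp add: algebra_simps)
    then show ?case using Suc sj by (simp add: smooth_jordan_param_def)
  qed simp
  show ?thesis
  proof (cases "n \<ge> 0")
    case True
    then show ?thesis using nat[of t "nat n"] by simp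
  next
    case False
    then show ?thesis using nat[of "t + 2 * pi * of_int n" "nat (- n)"] by (simp add: algebra_simps)
  qed
qed

lemma smooth_jordan_deriv_periodic: "tangent \<eta> (t + 2 * pi * of_int n) = tangent \<eta> t"
proof -
  have "((\<lambda>x. \<eta> (x + 2 * pi * of_int n)) has_vector_derivative tangent \<eta> (t + 2 * pi * of_int n)) (at t)"
    by (intro vector_diff_chain_at[of "\<lambda>x. x + 2 * pi * of_int n" 1 t \<eta>, unfolded o_def, simplified]
        smooth_jordan_has_vector_derivative) (auto intro!: derivative_eq_intros)
  then show ?thesis by (simp add: smooth_jordan_periodic vector_derivative_at)
qed

text \<open>Reduced to one period the two parameters coincide, so s - t is a multiple of 2 pi, and
  the only one of modulus below 2 pi is 0.\<close>

lemma smooth_jordan_inj: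
  assumes eq: "\<eta> s = \<eta> t" and lt: "\<bar>s - t\<bar> < 2 * pi" shows "s = t"
proof -
  obtain k l :: int where k: "0 \<le> s + 2 * pi * of_int k" "s + 2 * pi * of_int k < 2 * pi"
    and l: "0 \<le> t + 2 * pi * of_int l" "t + 2 * pi * of_int l < 2 * pi"
    using reduce_mod_2pi[of 0 s] reduce_mod_2pi[of 0 t] by auto
  have "inj_on \<eta> {0..<2*pi}" using sj by (simp add: smooth_jordan_param_def)
  moreover have "\<eta> (s + 2 * pi * of_int k) = \<eta> (t + 2 * pi * of_int l)"
    using eq by (simp add: smooth_jordan_periodic)
  ultimately have "s + 2 * pi * of_int k = t + 2 * pi * of_int l"
    using k l by (auto dest: inj_onD)
  then have st: "s - t = 2 * pi * of_int (l - k)" by (simp add: algebra_simps)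
  then have "2 * pi * \<bar>of_int (l - k)\<bar> < 2 * pi * 1" using lt by (simp add: abs_mult)
  then have "\<bar>of_int (l - k) :: real\<bar> < 1" by (subst (asm) mult_less_cancel_left_pos) auto
  then have "l - k = 0" by linarith
  then show ?thesis using st by simp
qed

lemma in_curve: "\<eta> t \<in> curve \<eta>"
proof -
  obtain n :: int where n: "0 \<le> t + 2 * pi * of_int n" "t + 2 * pi * of_int n < 2 * pi"
    using reduce_mod_2pi[of 0 t] by auto
  then have "\<eta> (t + 2 * pi * of_int n) \<in> curve \<eta>" unfolding curve_def by (intro imageI) auto
  then show ?thesis by (simp add: smooth_jordan_periodic)
qed

lemma compact_curve: "compact (curve \<eta>)"
  unfolding curve_def by (intro compact_continuous_image smooth_jordan_continuous) simp

lemma smooth_jordan_path: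
  defines "p \<equiv> \<lambda>x. \<eta> (2 * pi * x)"
  shows "simple_path p" "pathfinish p = pathstart p" "path_image p = curve \<eta>"
proof -
  have "path p" unfolding path_def p_def
    by (intro continuous_on_compose2[OF smooth_jordan_continuous[of UNIV]] continuous_intros) auto
  moreover have "loop_free p"
    unfolding loop_free_def
  proof (intro ballI impI)
    fix x y :: real assume xy: "x \<in> {0..1}" "y \<in> {0..1}" "p x = p y"
    show "x = y \<or> x = 0 \<and> y = 1 \<or> x = 1 \<and> y = 0"
    proof (cases "\<bar>x - y\<bar> < 1")
      case True
      have "\<bar>2 * pi * x - 2 * pi * y\<bar> = 2 * pi * \<bar>x - y\<bar>"
        by (simp add: abs_mult flip: right_diff_distrib)
      then have "2 * pi * x = 2 * pi * y"
        using xy(3) True by (intro smooth_jordan_inj) (simp_all add: p_def)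
      then show ?thesis by simp
    next
      case False
      then show ?thesis using xy by auto
    qed
  qed
  ultimately show "simple_path p" by (simp add: simple_path_def)
  show "pathfinish p = pathstart p"
    using smooth_jordan_periodic[of 0 1] by (simp add: p_def pathfinish_def pathstart_def)
  have "(\<lambda>x. 2 * pi * x) ` {0..1} = {0..2*pi}"
    using image_mult_atLeastAtMost[of "2*pi" 0 1] by simp
  then show "path_image p = curve \<eta>"
    unfolding path_image_def curve_def p_def by (metis image_image)
qed

text \<open>Near a point of the curve, the increment of \<open>\<eta>\<close> is almost parallel to the tangent, so it is
  not a multiple of the normal; far away, compactness gives a positive distance.\<close>

lemma normal_avoids_curve:
  assumes "closed C" "C \<inter> curve \<eta> = {}"
  obtains e0 where "e0 > 0"
    "\<And>t e. 0 < e \<Longrightarrow> e \<le> e0 \<Longrightarrow> \<eta> t + of_real e * (\<i> * tangent \<eta> t) \<notin> curve \<eta> \<union> C"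
proof -
  \<comment> \<open>A compact interval that contains [t - pi, t + pi] for every t in [0, 2 pi], so
    that M, b and d serve for all t at once.\<close>
  define I where "I = {-2*pi..4*pi}"
  have "compact (tangent \<eta> ` I)" unfolding I_def
    by (intro compact_continuous_image smooth_jordan_continuous_deriv) simp
  then obtain M where M: "M > 0" "\<And>t. t \<in> I \<Longrightarrow> cmod (tangent \<eta> t) \<le> M"
    by (auto dest!: compact_imp_bounded simp: bounded_pos)
  have "closed (tangent \<eta> ` I)" using \<open>compact (tangent \<eta> ` I)\<close> compact_imp_closed by blast
  moreover have "0 \<notin> tangent \<eta> ` I" using smooth_jordan_deriv_nonzero by force
  ultimately obtain b where b: "b > 0" "\<And>t. t \<in> I \<Longrightarrow> b \<le> cmod (tangent \<eta> t)"
    using separate_point_closed[of "tangent \<eta> ` I" 0] by (auto simp: dist_norm)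
  have "uniformly_continuous_on I (tangent \<eta>)"
    unfolding I_def by (intro compact_uniformly_continuous smooth_jordan_continuous_deriv) simp
  then obtain d where d: "d > 0"
    "\<And>s t. s \<in> I \<Longrightarrow> t \<in> I \<Longrightarrow> \<bar>s - t\<bar> < d \<Longrightarrow> cmod (tangent \<eta> s - tangent \<eta> t) < b / 2"
    using b(1) unfolding uniformly_continuous_on_def dist_norm real_norm_def by (metis half_gt_zero)
  \<comment> \<open>Pairs of parameters that are far apart but within half a period. Injectivity
    keeps 0 out of the compact set Q of chords, hence the chords have length at least some q >
    0.\<close>
  define P where "P = {(t, s). t \<in> {0..2*pi} \<and> \<bar>s - t\<bar> \<le> pi \<and> d \<le> \<bar>s - t\<bar>}"
  have "closed P"
  proof -
    have "P = {x. 0 \<le> fst x} \<inter> {x. fst x \<le> 2*pi} \<inter> {x. \<bar>snd x - fst x\<bar> \<le> pi} \<inter> {x. d \<le> \<bar>snd x - fst x\<bar>}"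
      by (auto simp: P_def)
    then show ?thesis by (auto intro!: closed_Int closed_Collect_le continuous_intros)
  qed
  moreover have "P \<subseteq> {0..2*pi} \<times> {-pi..3*pi}" by (auto simp: P_def)
  moreover have "compact ({0..2*pi} \<times> {-pi..3*pi})" by (intro compact_Times) auto
  ultimately have "compact P" by (metis closed_Int_compact inf.absorb1)
  define Q where "Q = (\<lambda>x. \<eta> (snd x) - \<eta> (fst x)) ` P"
  have "compact Q" unfolding Q_def
    by (intro compact_continuous_image \<open>compact P\<close> continuous_intros
        continuous_on_compose2[OF smooth_jordan_continuous[of UNIV]]) auto
  moreover have "0 \<notin> Q"
  proof
    assume "0 \<in> Q"
    then obtain t s where ts: "(t, s) \<in> P" "\<eta> s = \<eta> t" by (auto simp: Q_def)
    moreover have "\<bar>s - t\<bar> < 2 * pi" using ts(1) pi_gt_zero unfolding P_def by (simp, linarith)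
    ultimately have "s = t" by (intro smooth_jordan_inj)
    then show False using ts d(1) by (simp add: P_def)
  qed
  ultimately obtain q where q: "q > 0" "\<And>t s. (t, s) \<in> P \<Longrightarrow> q \<le> cmod (\<eta> s - \<eta> t)"
    using separate_point_closed[of Q 0] compact_imp_closed[of Q] by (force simp: dist_norm Q_def)
  obtain r where r: "r > 0" "\<And>x y. x \<in> curve \<eta> \<Longrightarrow> y \<in> C \<Longrightarrow> r \<le> dist x y"
    using separate_compact_closed[OF compact_curve assms(1)] assms(2) by blast
  \<comment> \<open>The displacement has length at most \<open>e0 * M\<close>, half of min q r: too
    short to reach a far part of the curve or the set C.\<close>
  define e0 where "e0 = min q r / (2 * M)"
  have e0: "e0 > 0" "e0 * M < q" "e0 * M < r" using q(1) r(1) M(1) by (auto simp: e0_def field_simps)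
  have main: "\<eta> t + of_real e * (\<i> * tangent \<eta> t) \<notin> curve \<eta> \<union> C"
    if e: "0 < e" "e \<le> e0" and t: "t \<in> {0..2*pi}" for t e
  proof
    let ?x = "\<eta> t + of_real e * (\<i> * tangent \<eta> t)"
    have tI: "t \<in> I" using t pi_gt_zero by (simp add: I_def)
    have "cmod (of_real e * (\<i> * tangent \<eta> t)) = e * cmod (tangent \<eta> t)" using e(1) by (simp add: norm_mult)
    also have "\<dots> \<le> e0 * M" using e e0 M(2)[OF tI] by (intro mult_mono) auto
    finally have small: "cmod (?x - \<eta> t) \<le> e0 * M" by simp
    assume "?x \<in> curve \<eta> \<union> C"
    then consider "?x \<in> C" | s where "?x = \<eta> s" by (auto simp: curve_def)
    then show False
    proof cases
      case 1
      then show False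
        using r(2)[OF in_curve 1, of t] small e0(3) by (simp add: dist_norm norm_minus_commute)
    next
      case (2 s0)
      \<comment> \<open>The parameter of the supposed point of the curve is moved to within pi of
        t.\<close>
      obtain n :: int where n: "t - pi \<le> s0 + 2 * pi * of_int n" "s0 + 2 * pi * of_int n < t - pi + 2 * pi"
        using reduce_mod_2pi[of "t - pi" s0] by auto
      define s where "s = s0 + 2 * pi * of_int n"
      have s: "\<bar>s - t\<bar> \<le> pi" "?x = \<eta> s"
        using n 2 by (auto simp: s_def smooth_jordan_periodic)
      show False
      proof (cases "\<bar>s - t\<bar> < d")
        case False
        then have "q \<le> cmod (\<eta> s - \<eta> t)" using s t by (intro q(2)) (auto simp: P_def)
        then show False using small s(2) e0(2) by simp
      next
        case True
        have "norm (\<eta> s - \<eta> t - (s - t) *\<^sub>R tangent \<eta> t) \<le> norm (s - t) * (b / 2)"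
        proof (rule vector_differentiable_bound_linearization[where S = "closed_segment t s"])
          fix x assume x: "x \<in> closed_segment t s"
          then have "\<bar>x - t\<bar> \<le> \<bar>s - t\<bar>" by (auto simp: closed_segment_eq_real_ivl split: if_splits)
          moreover from this have "x \<in> I" using s(1) t by (auto simp: I_def)
          ultimately show "norm (tangent \<eta> x - tangent \<eta> t) \<le> b / 2" using d(2)[OF _ tI, of x] True by force
        qed (auto intro: smooth_jordan_has_vector_derivative has_vector_derivative_at_within)
        \<comment> \<open>With the increment equal to e times the normal, the linearization error is
          a complex multiple of the tangent whose factor has real part t - s and imaginary part e.
          Its modulus is at least b |s - t| and b e, but at most |s - t| b / 2. This forces s = t
          and then e <= 0.\<close>
        also have "\<eta> s - \<eta> t - (s - t) *\<^sub>R tangent \<eta> t = (of_real e * \<i> - of_real (s - t)) * tangent \<eta> t"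
          using s(2)[symmetric] by (simp add: scaleR_conv_of_real algebra_simps)
        finally have 1: "cmod (of_real e * \<i> - of_real (s - t)) * cmod (tangent \<eta> t) \<le> \<bar>s - t\<bar> * (b / 2)"
          by (simp add: norm_mult)
        have "cmod (of_real e * \<i> - of_real (s - t)) * b \<le> cmod (of_real e * \<i> - of_real (s - t)) * cmod (tangent \<eta> t)"
          by (intro mult_left_mono b(2) tI) simp
        moreover have "\<bar>s - t\<bar> \<le> cmod (of_real e * \<i> - of_real (s - t))"
          using abs_Re_le_cmod[of "of_real e * \<i> - of_real (s - t)"] by simp
        moreover have "\<bar>e\<bar> \<le> cmod (of_real e * \<i> - of_real (s - t))"
          using abs_Im_le_cmod[of "of_real e * \<i> - of_real (s - t)"] by simp
        ultimately have "\<bar>s - t\<bar> * b \<le> \<bar>s - t\<bar> * (b / 2)" "\<bar>e\<bar> * b \<le> \<bar>s - t\<bar> * (b / 2)"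
          using 1 b(1) by (meson mult_right_mono order_trans less_imp_le)+
        then have "e * b \<le> 0" using e(1) by linarith
        then show False using mult_pos_pos[OF e(1) b(1)] by linarith
      qed
    qed
  qed
  show ?thesis
  proof (rule that[OF e0(1)])
    fix t e :: real assume e: "0 < e" "e \<le> e0"
    obtain n :: int where n: "0 \<le> t + 2 * pi * of_int n" "t + 2 * pi * of_int n < 2 * pi"
      using reduce_mod_2pi[of 0 t] by auto
    then show "\<eta> t + of_real e * (\<i> * tangent \<eta> t) \<notin> curve \<eta> \<union> C"
      using main[OF e, of "t + 2 * pi * of_int n"]
      by (simp add: smooth_jordan_periodic smooth_jordan_deriv_periodic)
  qed
qed

end

section \<open>Pushing a boundary curve into the domain\<close>

lemma frontier_finite_part:
  assumes K: "openin riemann_sphere K"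
  shows "frontier {z. Some z \<in> K} \<subseteq> {z. Some z \<in> riemann_sphere frontier_of K}"
proof safe
  fix z assume "z \<in> frontier {z. Some z \<in> K}"
  then have z: "z \<in> closure {z. Some z \<in> K}" "z \<notin> {z. Some z \<in> K}"
    using open_finite_part[OF K] by (auto simp: frontier_def interior_open)
  have "Some z \<in> riemann_sphere closure_of K"
    unfolding in_closure_of
  proof (intro conjI allI impI)
    fix T assume T: "Some z \<in> T \<and> openin riemann_sphere T"
    then have "open {z. Some z \<in> T}" "z \<in> {z. Some z \<in> T}" using open_finite_part by auto
    then have "{z. Some z \<in> T} \<inter> {z. Some z \<in> K} \<noteq> {}"
      using z(1) open_Int_closure_eq_empty[of "{z. Some z \<in> T}"] by blast
    then show "\<exists>y. y \<in> K \<and> y \<in> T" by blast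
  qed simp
  then show "Some z \<in> riemann_sphere frontier_of K"
    using z(2) K by (simp add: frontier_of_def interior_of_openin)
qed

text \<open>The band of points displaced by 0 < e <= \<open>e0\<close> along the left normals is
  connected, misses all boundary curves and meets K, so it lies in K. Its edge at \<open>e0\<close>
  is the loop \<sigma>, and shrinking the displacement to 0 is the homotopy to the boundary curve.
  On \<sigma>, unlike on the curve itself, contour integrals of functions holomorphic in K are
  available.\<close>

lemma push_off_loop:
  assumes sbd: "smoothly_bounded_domain K \<eta>"
  obtains \<sigma> where "valid_path \<sigma>" "pathfinish \<sigma> = pathstart \<sigma>" "path_image \<sigma> \<subseteq> {z. Some z \<in> K}"
    "homotopic_loops ({z. Some z \<in> K} \<union> curve (\<eta> i)) (\<lambda>x. \<eta> i (2 * pi * x)) \<sigma>"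
proof -
  let ?D = "tangent (\<eta> i)"
  have sj: "smooth_jordan_param (\<eta> j)" for j using sbd by (auto simp: smoothly_bounded_domain_def)
  have K: "openin riemann_sphere K" and left: "lies_left_of K (\<eta> i)"
    and fr: "riemann_sphere frontier_of K = Some ` (\<Union>j. curve (\<eta> j))"
    and dj: "disjoint_family (\<lambda>j. curve (\<eta> j))"
    using sbd by (auto simp: smoothly_bounded_domain_def)
  define C where "C = (\<Union>j\<in>-{i}. curve (\<eta> j))"
  have "closed C" unfolding C_def using compact_curve[OF sj] by (intro closed_UN) (auto intro: compact_imp_closed)
  moreover have "C \<inter> curve (\<eta> i) = {}" using dj by (auto simp: C_def disjoint_family_on_def)
  ultimately obtain e0 where e0: "e0 > 0"
    "\<And>t e. 0 < e \<Longrightarrow> e \<le> e0 \<Longrightarrow> \<eta> i t + of_real e * (\<i> * ?D t) \<notin> curve (\<eta> i) \<union> C"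
    using normal_avoids_curve[OF sj] by metis
  define G where "G = (\<lambda>x. \<eta> i (fst x) + of_real (snd x) * (\<i> * ?D (fst x)))"
  have contG: "continuous_on S G" for S unfolding G_def
    by (intro continuous_intros continuous_on_compose2[OF smooth_jordan_continuous[OF sj, of UNIV]]
        continuous_on_compose2[OF smooth_jordan_continuous_deriv[OF sj, of UNIV]]) auto
  define S where "S = G ` (UNIV \<times> {0<..e0})"
  have "connected S" unfolding S_def
    by (intro connected_continuous_image contG connected_Times) auto
  moreover have "S \<inter> frontier {z. Some z \<in> K} = {}"
  proof -
    have "S \<inter> (\<Union>j. curve (\<eta> j)) = {}"
      using e0(2) by (fastforce simp: S_def G_def C_def)
    then show ?thesis using frontier_finite_part[OF K] unfolding fr by auto
  qed
  moreover have "S \<inter> {z. Some z \<in> K} \<noteq> {}"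
  proof -
    have "\<forall>\<^sub>F e in at_right 0. Some (\<eta> i 0 + of_real e * (\<i> * ?D 0)) \<in> K"
      using left by (simp add: lies_left_of_def)
    moreover have "\<forall>\<^sub>F e in at_right 0. e \<in> {0<..e0}"
      using e0(1) by (auto simp: eventually_at_right intro!: exI[of _ e0])
    ultimately have "\<forall>\<^sub>F e in at_right 0. Some (\<eta> i 0 + of_real e * (\<i> * ?D 0)) \<in> K \<and> e \<in> {0<..e0}"
      by (rule eventually_conj)
    then obtain e where e: "Some (\<eta> i 0 + of_real e * (\<i> * ?D 0)) \<in> K" "e \<in> {0<..e0}"
      by (metis (mono_tags, lifting) eventually_happens trivial_limit_at_right_real)
    then have "G (0, e) \<in> S \<inter> {z. Some z \<in> K}" by (auto simp: S_def) (simp add: G_def)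
    then show ?thesis by blast
  qed
  ultimately have SK: "S \<subseteq> {z. Some z \<in> K}" using connected_Int_frontier[of S "{z. Some z \<in> K}"] by (metis Diff_eq_empty_iff)
  define \<sigma> where "\<sigma> = (\<lambda>x. G (2 * pi * x, e0))"
  have per: "\<eta> i (2 * pi) = \<eta> i 0" "?D (2 * pi) = ?D 0"
    using smooth_jordan_periodic[OF sj, of i 0 1] smooth_jordan_deriv_periodic[OF sj, of i 0 1]
    by simp_all
  have "valid_path \<sigma>"
  proof -
    have C1: "\<eta> i C1_differentiable_on UNIV" "?D C1_differentiable_on UNIV"
      using sj[of i] by (auto simp: smooth_jordan_param_def)
    \<comment> \<open>Finite fibres of the rescaling are a premise of the chain rule for C1
      curves.\<close>
    have "finite ({0..1} \<inter> (\<lambda>x. 2 * pi * x) -` {y})" for y :: real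
      by (rule finite_subset[of _ "{y / (2 * pi)}"]) auto
    then have "(\<lambda>x. \<eta> i (2 * pi * x)) C1_differentiable_on {0..1}"
      "(\<lambda>x. ?D (2 * pi * x)) C1_differentiable_on {0..1}"
      using C1_differentiable_compose[of "\<lambda>x. 2 * pi * x" "{0..1}" "\<eta> i"]
        C1_differentiable_compose[of "\<lambda>x. 2 * pi * x" "{0..1}" ?D] C1
      by (auto simp: o_def intro: C1_differentiable_on_subset)
    then have "\<sigma> C1_differentiable_on {0..1}"
      unfolding \<sigma>_def G_def fst_conv snd_conv
      by (intro C1_differentiable_on_add C1_differentiable_on_mult C1_differentiable_on_const)
    then show ?thesis unfolding valid_path_def by (rule C1_differentiable_imp_piecewise)
  qed
  moreover have "pathfinish \<sigma> = pathstart \<sigma>" using per by (simp add: \<sigma>_def G_def pathfinish_def pathstart_def)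
  moreover have "path_image \<sigma> \<subseteq> S" using e0(1) by (auto simp: path_image_def \<sigma>_def S_def)
  then have "path_image \<sigma> \<subseteq> {z. Some z \<in> K}" using SK by blast
  moreover have "homotopic_loops ({z. Some z \<in> K} \<union> curve (\<eta> i)) (\<lambda>x. \<eta> i (2 * pi * x)) \<sigma>"
    unfolding homotopic_loops
  \<comment> \<open>The first coordinate scales the displacement: 0 gives the boundary curve, 1
    gives \<sigma>.\<close>
  proof (intro exI[of _ "\<lambda>x. G (2 * pi * snd x, fst x * e0)"] conjI ballI funcsetI)
    show "continuous_on ({0..1} \<times> {0..1}) (\<lambda>x. G (2 * pi * snd x, fst x * e0))"
      by (intro continuous_on_compose2[OF contG[of UNIV]] continuous_intros) auto
    fix x :: "real \<times> real" assume x: "x \<in> {0..1} \<times> {0..1}"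
    show "G (2 * pi * snd x, fst x * e0) \<in> {z. Some z \<in> K} \<union> curve (\<eta> i)"
    proof (cases "fst x = 0")
      case True
      then show ?thesis using in_curve[OF sj] by (simp add: G_def)
    next
      case False
      then have "fst x * e0 \<in> {0<..e0}" using x e0(1) by (auto simp: mult_le_cancel_right1)
      then have "G (2 * pi * snd x, fst x * e0) \<in> S" by (auto simp: S_def)
      then show ?thesis using SK by blast
    qed
  qed (auto simp: G_def \<sigma>_def pathfinish_def pathstart_def per)
  ultimately show ?thesis using that by blast
qed

section \<open>Jordan curves bounding a domain of the sphere\<close>

text \<open>The inside, and the outside together with infinity, are disjoint open sets of the sphere
  covering K. As K is connected and contains infinity, it lies in the second.\<close>

lemma connected_sphere_subset_outside:
  assumes K: "connectedin riemann_sphere K" "None \<in> K"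
    and c: "simple_path c" "pathfinish c = pathstart c"
    and disj: "\<And>z. Some z \<in> K \<Longrightarrow> z \<notin> path_image c"
  shows "{z. Some z \<in> K} \<subseteq> outside (path_image c)"
proof (rule ccontr)
  let ?C = "path_image c"
  have J: "inside ?C \<union> outside ?C = - ?C" "inside ?C \<inter> outside ?C = {}" "open (inside ?C)"
    "open (outside ?C)" "bounded (inside ?C)"
    using Jordan_inside_outside[OF c] by simp_all
  assume "\<not> {z. Some z \<in> K} \<subseteq> outside ?C"
  then obtain z where z: "Some z \<in> K" "z \<in> inside ?C"
    using disj J by blast
  define E where "E = insert None (Some ` outside ?C)"
  \<comment> \<open>This makes the outside together with infinity a neighbourhood of
    infinity.\<close>
  have "compact (?C \<union> inside ?C)"
  proof -
    have "?C \<union> inside ?C = - outside ?C" using J by blast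
    moreover have "closed (- outside ?C)" using J by (simp add: open_closed)
    moreover have "bounded (?C \<union> inside ?C)"
      using J c(1) by (simp add: bounded_simple_path_image)
    ultimately show ?thesis by (simp add: compact_eq_bounded_closed)
  qed
  then have "openin riemann_sphere E"
    using openin_riemann_sphere_complement[of "?C \<union> inside ?C"] unfolding E_def
    by (simp add: outside_inside Un_commute)
  moreover have "openin riemann_sphere (Some ` inside ?C)"
    using J by (simp add: openin_riemann_sphere_Some)
  moreover have "K \<subseteq> Some ` inside ?C \<union> E"
  proof
    fix q assume "q \<in> K"
    show "q \<in> Some ` inside ?C \<union> E"
    proof (cases q)
      case (Some a)
      then have "a \<in> inside ?C \<union> outside ?C" using disj \<open>q \<in> K\<close> J(1) by blast
      then show ?thesis using Some unfolding E_def by blast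
    qed (simp add: E_def)
  qed
  moreover have "Some ` inside ?C \<inter> E \<inter> K = {}" using J(2) unfolding E_def by blast
  moreover have "Some ` inside ?C \<inter> K \<noteq> {}" "E \<inter> K \<noteq> {}" using z K(2) by (auto simp: E_def)
  ultimately show False using connectedinD[OF K(1), of "Some ` inside ?C" E] by simp
qed

text \<open>The common set S rules out nesting: both curves lie in its closure, so each is outside
  the other. Then the inside of \<open>c1\<close> is connected, misses the second curve, and has
  points outside it close to the first curve.\<close>

lemma disjoint_jordan_inside_subset_outside:
  fixes c1 c2 :: "real \<Rightarrow> complex"
  assumes c1: "simple_path c1" "pathfinish c1 = pathstart c1"
    and c2: "simple_path c2" "pathfinish c2 = pathstart c2"
    and disj: "path_image c1 \<inter> path_image c2 = {}"
    and S: "S \<subseteq> outside (path_image c1)" "S \<subseteq> outside (path_image c2)"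
    and cl: "path_image c1 \<subseteq> closure S" "path_image c2 \<subseteq> closure S"
  shows "inside (path_image c1) \<subseteq> outside (path_image c2)"
proof -
  let ?C1 = "path_image c1" and ?C2 = "path_image c2"
  note J1 = Jordan_inside_outside[OF c1] and J2 = Jordan_inside_outside[OF c2]
  have closed: "closure (outside (path_image c)) \<subseteq> outside (path_image c) \<union> path_image c"
    if "simple_path c" "pathfinish c = pathstart c" for c :: "real \<Rightarrow> complex"
  proof -
    note J = Jordan_inside_outside[OF that]
    have "outside (path_image c) \<union> path_image c = - inside (path_image c)" using J by blast
    moreover have "closed (- inside (path_image c))" using J by (simp add: open_closed)
    ultimately show ?thesis by (intro closure_minimal) auto
  qed
  have "closure S \<subseteq> outside ?C1 \<union> ?C1" "closure S \<subseteq> outside ?C2 \<union> ?C2"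
    using closure_mono[OF S(1)] closure_mono[OF S(2)] closed[OF c1] closed[OF c2]
    by (meson subset_trans)+
  then have 12: "?C1 \<subseteq> outside ?C2" and 21: "?C2 \<subseteq> outside ?C1"
    using cl disj by blast+
  have "inside ?C1 \<inter> outside ?C1 = {}" "inside ?C2 \<union> outside ?C2 = - ?C2"
    using J1 J2 by simp_all
  then have sub: "inside ?C1 \<subseteq> inside ?C2 \<union> outside ?C2" using 21 by blast
  \<comment> \<open>A point of the first curve is a limit of points of its inside and lies in the
    open outside of the second.\<close>
  have "?C1 \<noteq> {}" by simp
  then obtain x where "x \<in> ?C1" by blast
  then have "x \<in> closure (inside ?C1)" "x \<in> outside ?C2"
    using J1 12 by (auto simp: frontier_def)
  then have "outside ?C2 \<inter> inside ?C1 \<noteq> {}"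
    using J2 open_Int_closure_eq_empty[of "outside ?C2" "inside ?C1"] by (metis IntI empty_iff)
  then have "inside ?C2 \<inter> inside ?C1 = {}"
    using J1 J2 sub connectedD[of "inside ?C1" "inside ?C2" "outside ?C2"]
    by (metis Int_assoc Int_empty_right inf_commute)
  then show ?thesis using sub by blast
qed

lemma closure_finite_part:
  assumes "Some z \<in> riemann_sphere closure_of K" shows "z \<in> closure {z. Some z \<in> K}"
proof (rule ccontr)
  let ?V = "- closure {z. Some z \<in> K}"
  assume "z \<notin> closure {z. Some z \<in> K}"
  then have "Some z \<in> Some ` ?V \<and> openin riemann_sphere (Some ` ?V)"
    by (simp add: openin_riemann_sphere_Some open_Compl)
  then obtain q where "q \<in> K" "q \<in> Some ` ?V"
    using assms[unfolded in_closure_of, THEN conjunct2, THEN spec, of "Some ` ?V"] by auto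
  then show False using closure_subset[of "{z. Some z \<in> K}"] by blast
qed

text \<open>Stated for general loops because it serves twice: for the boundary curves of K with the
  points \<alpha>, and for their images bounding the lemniscatic domain with the centres a. The sign
  of the first winding number stays open.\<close>

lemma winding_number_disjoint_jordan:
  fixes c :: "'l \<Rightarrow> real \<Rightarrow> complex" and \<beta> :: "'l \<Rightarrow> complex"
  assumes K: "connectedin riemann_sphere K" "None \<in> K"
    and c: "\<And>i. simple_path (c i)" "\<And>i. pathfinish (c i) = pathstart (c i)"
    and off: "\<And>i z. Some z \<in> K \<Longrightarrow> z \<notin> path_image (c i)"
    and disj: "\<And>i j. i \<noteq> j \<Longrightarrow> path_image (c i) \<inter> path_image (c j) = {}"
    and cl: "\<And>i. path_image (c i) \<subseteq> closure {z. Some z \<in> K}"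
    and \<beta>: "\<And>i. \<beta> i \<in> inside (path_image (c i))"
  shows "winding_number (c i) (\<beta> i) \<in> {1, -1}"
    and "j \<noteq> i \<Longrightarrow> winding_number (c i) (\<beta> j) = 0"
    and "\<beta> j \<notin> path_image (c i)" and "Some (\<beta> j) \<notin> K"
proof -
  have out: "{z. Some z \<in> K} \<subseteq> outside (path_image (c i))" for i
    using K c off by (rule connected_sphere_subset_outside)
  show "winding_number (c i) (\<beta> i) \<in> {1, -1}"
    using simple_closed_path_winding_number_inside[OF c(1)[of i]] \<beta>[of i] by (metis insertCI)
  have io: "\<beta> j \<in> outside (path_image (c i))" if "j \<noteq> i" for i j
  proof -
    have "inside (path_image (c j)) \<subseteq> outside (path_image (c i))"
      using that by (intro disjoint_jordan_inside_subset_outside[OF c c disj out out cl cl])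
    then show ?thesis using \<beta> by blast
  qed
  show "winding_number (c i) (\<beta> j) = 0" if "j \<noteq> i"
    using io[OF that] c(2)[of i] simple_path_imp_path[OF c(1)[of i]]
    by (intro winding_number_zero_in_outside) auto
  show "\<beta> j \<notin> path_image (c i)"
  proof (cases "j = i")
    case True
    then show ?thesis using \<beta>[of i] inside_no_overlap[of "path_image (c i)"] by blast
  next
    case False
    then show ?thesis using io[OF False] outside_no_overlap[of "path_image (c i)"] by blast
  qed
  show "Some (\<beta> j) \<notin> K"
    using out[of j] \<beta>[of j] Jordan_inside_outside[OF c(1,2)[of j]] by blast
qed

section \<open>Logarithmic potentials and winding numbers\<close>

text \<open>The real derivative of Re W is the map h to Re (H h). If it vanishes, taking h = cnj H
  gives |H|^2 = 0.\<close>

lemma deriv_zero_if_Re_constant: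
  assumes W: "(W has_field_derivative H) (at z)" and const: "\<forall>\<^sub>F x in nhds z. Re (W x) = C"
  shows "H = 0"
proof -
  have "((\<lambda>x. Re (W x)) has_derivative (\<lambda>h. Re (H * h))) (at z)"
    using W by (intro bounded_linear.has_derivative[OF bounded_linear_Re])
      (simp add: has_field_derivative_def)
  moreover have "((\<lambda>x. Re (W x)) has_derivative (\<lambda>h. 0)) (at z)"
  proof (rule has_derivative_transform_eventually[of "\<lambda>_. C"])
    show "\<forall>\<^sub>F x in at z. C = Re (W x)"
      using const by (auto simp: eventually_nhds_conv_at elim: eventually_mono)
    show "C = Re (W z)" using eventually_nhds_x_imp_x[OF const] by simp
  qed auto
  ultimately have "(\<lambda>h. Re (H * h)) = (\<lambda>h. 0)" by (rule has_derivative_unique)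
  then have "Re (H * cnj H) = 0" by (rule fun_cong)
  then show "H = 0" by (simp add: complex_mult_cnj flip: power2_eq_square) (metis complex_eq_0 power2_eq_square sum_power2_eq_zero_iff)
qed

text \<open>Substitution w = \<phi> z in the integral of 1 / (w - a) along the image path.\<close>

lemma has_contour_integral_winding_number_comp:
  assumes \<phi>: "\<phi> holomorphic_on S" "open S" and \<sigma>: "valid_path \<sigma>" "path_image \<sigma> \<subseteq> S"
    and a: "\<And>z. z \<in> S \<Longrightarrow> \<phi> z \<noteq> a"
  shows "((\<lambda>z. deriv \<phi> z / (\<phi> z - a)) has_contour_integral
    2 * of_real pi * \<i> * winding_number (\<phi> \<circ> \<sigma>) a) \<sigma>"
proof -
  have an: "\<phi> analytic_on S" using \<phi> analytic_on_open by blast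
  have "valid_path (\<phi> \<circ> \<sigma>)"
    using valid_path_compose_analytic[OF \<sigma>(1) an \<sigma>(2)] .
  moreover have "a \<notin> path_image (\<phi> \<circ> \<sigma>)"
    using a \<sigma>(2) by (force simp: path_image_compose)
  ultimately have "winding_number (\<phi> \<circ> \<sigma>) a = 1 / (2 * of_real pi * \<i>) * contour_integral (\<phi> \<circ> \<sigma>) (\<lambda>w. 1 / (w - a))"
    by (simp add: winding_number_valid_path)
  also have "contour_integral (\<phi> \<circ> \<sigma>) (\<lambda>w. 1 / (w - a)) = contour_integral \<sigma> (\<lambda>z. deriv \<phi> z / (\<phi> z - a))"
    using contour_integral_comp_analyticW[OF an \<sigma>] by simp
  finally have "contour_integral \<sigma> (\<lambda>z. deriv \<phi> z / (\<phi> z - a)) =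
      2 * of_real pi * \<i> * winding_number (\<phi> \<circ> \<sigma>) a"
    by (simp del: o_apply add: o_def)
  moreover have "(\<lambda>z. deriv \<phi> z / (\<phi> z - a)) contour_integrable_on \<sigma>"
    using assms by (intro contour_integrable_holomorphic_simple[OF _ \<phi>(2) \<sigma>] holomorphic_intros) auto
  ultimately show ?thesis using has_contour_integral_integral by metis
qed

text \<open>The vanishing potential is locally the real part of an analytic function, whose
  derivative H must be 0. In the integral of H along the loop, the terms with
  \<open>deriv (g j)\<close> contribute nothing and each logarithmic derivative contributes 2 pi i
  times a winding number.\<close>

lemma log_potential_winding:
  fixes a \<alpha> :: "'l::finite \<Rightarrow> complex" and m n :: "'l \<Rightarrow> real" and g :: "'l \<Rightarrow> complex \<Rightarrow> complex"
  assumes S: "open S" and \<phi>: "\<phi> holomorphic_on S" and g: "\<And>j. g j holomorphic_on S"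
    and a: "\<And>j z. z \<in> S \<Longrightarrow> \<phi> z \<noteq> a j" and \<alpha>: "\<And>j. \<alpha> j \<notin> S"
    and zero: "\<And>z. z \<in> S \<Longrightarrow> (\<Sum>j\<in>UNIV. m j * ln (cmod (\<phi> z - a j))) -
        (\<Sum>j\<in>UNIV. n j * (Re (g j z) + ln (cmod (z - \<alpha> j)))) = 0"
    and \<sigma>: "valid_path \<sigma>" "path_image \<sigma> \<subseteq> S" "pathfinish \<sigma> = pathstart \<sigma>"
  shows "(\<Sum>j\<in>UNIV. m j * winding_number (\<phi> \<circ> \<sigma>) (a j)) = (\<Sum>j\<in>UNIV. n j * winding_number \<sigma> (\<alpha> j))"
proof -
  define H where "H z = (\<Sum>j\<in>UNIV. of_real (m j) * (deriv \<phi> z / (\<phi> z - a j))) -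
      (\<Sum>j\<in>UNIV. of_real (n j) * (deriv (g j) z + 1 / (z - \<alpha> j)))" for z
  have H0: "H z = 0" if z: "z \<in> S" for z
  proof (rule deriv_zero_if_Re_constant)
    \<comment> \<open>A primitive of H near z. Dividing by the values at z makes each argument of
      \<open>Ln\<close> equal to 1 at x = z, away from the branch cut; the real constants lost in
      this way make up \<open>?C\<close>.\<close>
    define W where "W x = (\<Sum>j\<in>UNIV. of_real (m j) * Ln ((\<phi> x - a j) / (\<phi> z - a j))) -
      (\<Sum>j\<in>UNIV. of_real (n j) * (g j x + Ln ((x - \<alpha> j) / (z - \<alpha> j))))" for x
    have z\<alpha>: "z \<noteq> \<alpha> j" for j using z \<alpha> by blast
    have d\<phi>: "(\<phi> has_field_derivative deriv \<phi> z) (at z)" using \<phi> S z by (rule holomorphic_derivI)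
    have dg: "(g j has_field_derivative deriv (g j) z) (at z)" for j using g S z by (rule holomorphic_derivI)
    have 1: "((\<lambda>x. Ln ((\<phi> x - a j) / (\<phi> z - a j))) has_field_derivative deriv \<phi> z / (\<phi> z - a j)) (at z)" for j
      using a[OF z, of j] by (auto intro!: derivative_eq_intros d\<phi> simp: divide_simps)
    have 2: "((\<lambda>x. Ln ((x - \<alpha> j) / (z - \<alpha> j))) has_field_derivative 1 / (z - \<alpha> j)) (at z)" for j
      using z\<alpha>[of j] by (auto intro!: derivative_eq_intros simp: divide_simps)
    show "(W has_field_derivative H z) (at z)"
      unfolding W_def H_def by (intro DERIV_diff DERIV_sum DERIV_cmult DERIV_add 1 2 dg)
    let ?C = "(\<Sum>j\<in>UNIV. n j * ln (cmod (z - \<alpha> j))) - (\<Sum>j\<in>UNIV. m j * ln (cmod (\<phi> z - a j)))"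
    have "\<forall>\<^sub>F x in nhds z. x \<in> S" using S z by (rule eventually_nhds_in_open)
    then show "\<forall>\<^sub>F x in nhds z. Re (W x) = ?C"
    proof eventually_elim
      case (elim x)
      have "x \<noteq> \<alpha> j" for j using elim \<alpha> by blast
      then have "Re (W x) = (\<Sum>j\<in>UNIV. m j * (ln (cmod (\<phi> x - a j)) - ln (cmod (\<phi> z - a j)))) -
          (\<Sum>j\<in>UNIV. n j * (Re (g j x) + (ln (cmod (x - \<alpha> j)) - ln (cmod (z - \<alpha> j)))))"
        unfolding W_def using a[OF z] a[OF elim] z\<alpha>
        by (simp add: norm_divide ln_div)
      also have "\<dots> = (\<Sum>j\<in>UNIV. m j * ln (cmod (\<phi> x - a j))) -
        (\<Sum>j\<in>UNIV. n j * (Re (g j x) + ln (cmod (x - \<alpha> j)))) + ?C"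
        by (simp add: algebra_simps sum.distrib sum_subtractf)
      finally show ?case using zero[OF elim] by simp
    qed
  qed
  let ?c = "2 * of_real pi * \<i>"
  have 1: "((\<lambda>z. deriv \<phi> z / (\<phi> z - a j)) has_contour_integral ?c * winding_number (\<phi> \<circ> \<sigma>) (a j)) \<sigma>" for j
    using \<phi> S \<sigma>(1,2) a by (rule has_contour_integral_winding_number_comp)
  have 2: "((\<lambda>z. deriv (g j) z + 1 / (z - \<alpha> j)) has_contour_integral ?c * winding_number \<sigma> (\<alpha> j)) \<sigma>" for j
  proof -
    \<comment> \<open>The function \<open>g j\<close> is a single-valued primitive and \<sigma> is
      closed.\<close>
    have "(deriv (g j) has_contour_integral 0) \<sigma>"
      using \<sigma> holomorphic_derivI[OF g S]
      by (intro Cauchy_theorem_primitive[of S "g j"]) (auto intro: has_field_derivative_at_within)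
    moreover have "((\<lambda>z. 1 / (z - \<alpha> j)) has_contour_integral ?c * winding_number \<sigma> (\<alpha> j)) \<sigma>"
      using \<sigma>(1,2) \<alpha>[of j] has_contour_integral_winding_number[of \<sigma> "\<alpha> j"] by auto
    ultimately show ?thesis using has_contour_integral_add by fastforce
  qed
  have "(H has_contour_integral
      (\<Sum>j\<in>UNIV. of_real (m j) * (?c * winding_number (\<phi> \<circ> \<sigma>) (a j))) -
      (\<Sum>j\<in>UNIV. of_real (n j) * (?c * winding_number \<sigma> (\<alpha> j)))) \<sigma>"
    unfolding H_def
    by (intro has_contour_integral_diff has_contour_integral_sum has_contour_integral_lmul 1 2) auto
  moreover have "(H has_contour_integral 0) \<sigma>"
    using \<sigma>(2) by (intro has_contour_integral_is_0 H0) auto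
  ultimately have "(\<Sum>j\<in>UNIV. of_real (m j) * (?c * winding_number (\<phi> \<circ> \<sigma>) (a j))) -
      (\<Sum>j\<in>UNIV. of_real (n j) * (?c * winding_number \<sigma> (\<alpha> j))) = 0"
    by (rule has_contour_integral_unique)
  then have "?c * ((\<Sum>j\<in>UNIV. m j * winding_number (\<phi> \<circ> \<sigma>) (a j)) -
      (\<Sum>j\<in>UNIV. n j * winding_number \<sigma> (\<alpha> j))) = 0"
    by (simp add: sum_distrib_left right_diff_distrib mult.left_commute)
  then show ?thesis by simp
qed

section \<open>Walsh's map\<close>

locale walsh_setting =
  fixes K :: "complex option set" and \<eta> :: "'l::finite \<Rightarrow> real \<Rightarrow> complex"
    and a :: "'l \<Rightarrow> complex" and m :: "'l \<Rightarrow> real" and \<tau> :: real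
    and \<Phi> :: "complex option \<Rightarrow> complex option"
  assumes sbd: "smoothly_bounded_domain K \<eta>" and walsh: "walsh_map K \<eta> a m \<tau> \<Phi>"
begin

abbreviation "K' \<equiv> {z. Some z \<in> K}"
abbreviation "\<Gamma> \<equiv> (\<Union>j. curve (\<eta> j))"
text \<open>Meaningful only where \<Phi> takes a finite value; by \<open>Phi_Some\<close> this holds
  on \<open>K'\<close> and on the boundary curves.\<close>

abbreviation "\<phi> \<equiv> \<lambda>z. the (\<Phi> (Some z))"
abbreviation "L \<equiv> lemniscatic_domain a m \<tau>"

lemma domain_facts:
  shows domain_open: "openin riemann_sphere K" and domain_connected: "connectedin riemann_sphere K"
    and domain_infinity: "None \<in> K" and domain_smooth: "\<And>j. smooth_jordan_param (\<eta> j)"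
    and domain_disjoint: "\<And>i j. i \<noteq> j \<Longrightarrow> curve (\<eta> i) \<inter> curve (\<eta> j) = {}"
    and domain_frontier: "riemann_sphere frontier_of K = Some ` \<Gamma>"
  using sbd by (simp_all add: smoothly_bounded_domain_def disjoint_family_on_def)

lemma walsh_facts:
  shows walsh_pos: "\<And>j. m j > 0" and walsh_tau: "\<tau> > 0" and walsh_sum: "(\<Sum>j\<in>UNIV. m j) = 1"
    and walsh_bij: "bij_betw \<Phi> K L" and walsh_infinity: "\<Phi> None = None"
    and walsh_asymp: "(\<lambda>z. \<phi> z - z) \<in> O[at_infinity](\<lambda>z. 1 / z)"
    and walsh_cont: "continuous_map (subtopology riemann_sphere (riemann_sphere closure_of K)) riemann_sphere \<Phi>"
    and walsh_inj: "inj_on \<Phi> (riemann_sphere closure_of K)"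
    and walsh_inside: "\<And>j. a j \<in> inside {w. Some w \<in> \<Phi> ` Some ` curve (\<eta> j)}"
    and walsh_analytic: "\<And>p. p \<in> K \<Longrightarrow> (\<lambda>w. sphere_coord (\<Phi> p) (\<Phi> (sphere_chart p w))) analytic_on {0}"
    and walsh_cont_K: "continuous_map (subtopology riemann_sphere K) riemann_sphere \<Phi>"
  using walsh
  by (simp_all add: walsh_map_def conformal_bijection_def sphere_holomorphic_map_def bij_betw_def)

lemma open_K': "open K'" using domain_open by (rule open_finite_part)

lemma curves_eq: "Some ` \<Gamma> = riemann_sphere closure_of K - K"
  using domain_frontier domain_open by (simp add: frontier_of_def interior_of_openin)

lemma curves_disjoint_K: "z \<in> \<Gamma> \<Longrightarrow> Some z \<notin> K"
  using curves_eq by blast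

lemma K_subset_closure: "K \<subseteq> riemann_sphere closure_of K"
  by (simp add: closure_of_subset)

lemma curves_subset_closure_of: "z \<in> \<Gamma> \<Longrightarrow> Some z \<in> riemann_sphere closure_of K"
  using curves_eq by blast

lemma closure_K': "closure K' = K' \<union> \<Gamma>"
proof
  show "closure K' \<subseteq> K' \<union> \<Gamma>"
    using frontier_finite_part[OF domain_open] unfolding domain_frontier
    by (auto simp: closure_Un_frontier)
  show "K' \<union> \<Gamma> \<subseteq> closure K'"
    using closure_subset[of K'] closure_finite_part curves_subset_closure_of by blast
qed

text \<open>Infinity is already the image of infinity, and \<Phi> is injective on the
  closure.\<close>

lemma Phi_Some: "z \<in> K' \<union> \<Gamma> \<Longrightarrow> \<Phi> (Some z) = Some (\<phi> z)"
proof -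
  assume "z \<in> K' \<union> \<Gamma>"
  then have "Some z \<in> riemann_sphere closure_of K"
    using K_subset_closure curves_subset_closure_of by blast
  moreover have "None \<in> riemann_sphere closure_of K" using K_subset_closure domain_infinity by blast
  ultimately have "\<Phi> (Some z) \<noteq> \<Phi> None" using walsh_inj by (auto dest: inj_onD)
  then show ?thesis by (simp add: walsh_infinity)
qed

lemma phi_inj: "inj_on \<phi> (K' \<union> \<Gamma>)"
proof (rule inj_onI)
  fix x y assume xy: "x \<in> K' \<union> \<Gamma>" "y \<in> K' \<union> \<Gamma>" "\<phi> x = \<phi> y"
  then have "\<Phi> (Some x) = \<Phi> (Some y)" using Phi_Some by metis
  moreover have "Some x \<in> riemann_sphere closure_of K" "Some y \<in> riemann_sphere closure_of K"
    using xy K_subset_closure curves_subset_closure_of by blast+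
  ultimately show "x = y" using walsh_inj by (auto dest: inj_onD)
qed

lemma phi_continuous: "continuous_on (K' \<union> \<Gamma>) \<phi>"
proof (rule continuous_map_finite_part[OF walsh_cont])
  fix z assume "z \<in> K' \<union> \<Gamma>"
  then show "Some z \<in> riemann_sphere closure_of K \<and> \<Phi> (Some z) \<noteq> None"
    using K_subset_closure curves_subset_closure_of Phi_Some by blast
qed

lemma phi_holomorphic: "\<phi> holomorphic_on K'"
proof -
  have "\<phi> analytic_on {z}" if z: "z \<in> K'" for z
  proof -
    \<comment> \<open>At a finite point the local coordinate of the value is the increment of
      \<phi>; translation and a constant recover \<phi>.\<close>
    have "(\<lambda>w. \<phi> (z + w) - \<phi> z) analytic_on {0}"
    proof -
      have "\<Phi> (Some z) = Some (\<phi> z)" using z by (intro Phi_Some) blast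
      then have "sphere_coord (\<Phi> (Some z)) q = the q - \<phi> z" for q
        by (metis sphere_coord.simps(1))
      then show ?thesis using walsh_analytic[of "Some z"] z by simp
    qed
    then have "(\<lambda>w. \<phi> (z + w) - \<phi> z) analytic_on (\<lambda>x. x - z) ` {z}" by simp
    then have "(\<lambda>w. \<phi> (z + w) - \<phi> z) \<circ> (\<lambda>x. x - z) analytic_on {z}"
      by (rule analytic_on_compose[rotated]) (intro analytic_intros)
    then have "(\<lambda>x. (\<phi> x - \<phi> z) + \<phi> z) analytic_on {z}"
      by (intro analytic_on_add analytic_on_const) (simp add: o_def)
    then show ?thesis by simp
  qed
  then have "\<phi> analytic_on K'" by (subst analytic_on_analytic_at) blast
  then show ?thesis by (rule analytic_imp_holomorphic)
qed

abbreviation "lemniscate_prod w \<equiv> (\<Prod>j\<in>UNIV. cmod (w - a j) powr m j)"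

lemma in_lemniscatic: "Some w \<in> L \<longleftrightarrow> lemniscate_prod w > \<tau>"
  by (auto simp: lemniscatic_domain_def)

lemma phi_in_L: "z \<in> K' \<Longrightarrow> Some (\<phi> z) \<in> L"
proof -
  assume z: "z \<in> K'"
  then have "\<Phi> (Some z) = Some (\<phi> z)" by (intro Phi_Some) blast
  moreover have "\<Phi> (Some z) \<in> L" using z by (intro bij_betw_apply[OF walsh_bij]) blast
  ultimately show ?thesis by argo
qed

text \<open>All values in \<open>L\<close> are already taken on K, and \<Phi> is injective on the
  closure.\<close>

lemma phi_notin_L: "z \<in> \<Gamma> \<Longrightarrow> Some (\<phi> z) \<notin> L"
proof
  assume z: "z \<in> \<Gamma>" and "Some (\<phi> z) \<in> L"
  then have "\<Phi> (Some z) \<in> \<Phi> ` K" using Phi_Some[of z] walsh_bij by (auto simp: bij_betw_def)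
  then obtain q where "q \<in> K" "\<Phi> q = \<Phi> (Some z)" by force
  then have "q = Some z"
    using walsh_inj K_subset_closure curves_subset_closure_of[OF z] by (auto dest: inj_onD)
  then show False using \<open>q \<in> K\<close> curves_disjoint_K[OF z] by simp
qed

lemma centre_notin_L: "Some (a j) \<notin> L"
proof -
  have "lemniscate_prod (a j) = 0"
    by (rule prod_zero) (auto intro!: bexI[of _ j])
  then show ?thesis using walsh_tau unfolding in_lemniscatic by linarith
qed

lemma phi_ne_centre: "z \<in> K' \<Longrightarrow> \<phi> z \<noteq> a j"
  using phi_in_L[of z] centre_notin_L[of j] by auto

text \<open>The product exceeds \<tau> on \<open>K'\<close>, so by continuity it is at least \<tau>
  on the curves; their images are not in \<open>L\<close>, so it is at most \<tau>. As \<tau> > 0,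
  no factor vanishes and logarithms may be taken.\<close>

lemma phi_boundary:
  assumes "z \<in> \<Gamma>"
  shows "(\<Sum>j\<in>UNIV. m j * ln (cmod (\<phi> z - a j))) = ln \<tau>" and "\<phi> z \<noteq> a j"
proof -
  have "(\<lambda>z. lemniscate_prod (\<phi> z)) ` closure K' \<subseteq> {\<tau>..}"
  proof (rule image_closure_subset)
    \<comment> \<open>On the curves \<phi> is not yet known to avoid the centres; positive exponents
      keep the powers continuous at base 0.\<close>
    show "continuous_on (closure K') (\<lambda>z. lemniscate_prod (\<phi> z))"
      unfolding closure_K'
      by (intro continuous_on_prod continuous_on_powr' continuous_intros phi_continuous)
        (auto simp: walsh_pos)
    show "(\<lambda>z. lemniscate_prod (\<phi> z)) ` K' \<subseteq> {\<tau>..}"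
      using phi_in_L in_lemniscatic by (force intro: less_imp_le)
  qed simp
  then have "\<tau> \<le> lemniscate_prod (\<phi> z)" using assms closure_K' by blast
  moreover have "lemniscate_prod (\<phi> z) \<le> \<tau>"
    using phi_notin_L[OF assms] in_lemniscatic by simp
  ultimately have eq: "lemniscate_prod (\<phi> z) = \<tau>" by simp
  show ne: "\<phi> z \<noteq> a j" for j
  proof
    assume "\<phi> z = a j"
    then have "lemniscate_prod (\<phi> z) = 0"
      by (intro prod_zero) (auto intro!: bexI[of _ j])
    then show False using eq walsh_tau by simp
  qed
  have "ln \<tau> = (\<Sum>j\<in>UNIV. ln (cmod (\<phi> z - a j) powr m j))"
    unfolding eq[symmetric] by (rule ln_prod) (auto simp: ne)
  also have "\<dots> = (\<Sum>j\<in>UNIV. m j * ln (cmod (\<phi> z - a j)))"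
    by (intro sum.cong) (auto simp: ln_powr ne)
  finally show "(\<Sum>j\<in>UNIV. m j * ln (cmod (\<phi> z - a j))) = ln \<tau>" by simp
qed

section \<open>Winding numbers of the boundary curves and of their images\<close>

lemma curve_windings:
  assumes \<alpha>: "\<And>j. \<alpha> j \<in> inside (curve (\<eta> j))"
  shows "winding_number (\<lambda>x. \<eta> i (2 * pi * x)) (\<alpha> i) \<in> {1, -1}"
    and "j \<noteq> i \<Longrightarrow> winding_number (\<lambda>x. \<eta> i (2 * pi * x)) (\<alpha> j) = 0"
    and "\<alpha> j \<notin> curve (\<eta> i)" and "Some (\<alpha> j) \<notin> K"
proof -
  have *: "curve (\<eta> k) \<subseteq> closure K'" for k using closure_K' by blast
  have off: "z \<notin> curve (\<eta> k)" if "Some z \<in> K" for z k using curves_disjoint_K that by blast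
  note w = winding_number_disjoint_jordan[OF domain_connected domain_infinity,
      where c = "\<lambda>i x. \<eta> i (2 * pi * x)" and \<beta> = \<alpha>,
      unfolded smooth_jordan_path(3)[OF domain_smooth],
      OF smooth_jordan_path(1,2)[OF domain_smooth] off domain_disjoint * \<alpha>]
  show "winding_number (\<lambda>x. \<eta> i (2 * pi * x)) (\<alpha> i) \<in> {1, -1}"
    and "j \<noteq> i \<Longrightarrow> winding_number (\<lambda>x. \<eta> i (2 * pi * x)) (\<alpha> j) = 0"
    and "\<alpha> j \<notin> curve (\<eta> i)" and "Some (\<alpha> j) \<notin> K"
    using w(1)[of i] w(2)[of j i] w(3)[of j i] w(4)[of j] by simp_all
qed

text \<open>The Jordan curve argument applies on the image side too: \<open>L\<close> is connected
  as the image of K, and \<phi> is continuous and injective up to the boundary, so the image curves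
  are disjoint simple loops in the closure of the finite part of \<open>L\<close>.\<close>

lemma image_curve_windings:
  shows "winding_number (\<phi> \<circ> (\<lambda>x. \<eta> i (2 * pi * x))) (a i) \<in> {1, -1}"
    and "j \<noteq> i \<Longrightarrow> winding_number (\<phi> \<circ> (\<lambda>x. \<eta> i (2 * pi * x))) (a j) = 0"
proof -
  define c where "c i = \<phi> \<circ> (\<lambda>x. \<eta> i (2 * pi * x))" for i
  have im: "path_image (c i) = \<phi> ` curve (\<eta> i)" for i
    unfolding c_def path_image_compose smooth_jordan_path(3)[OF domain_smooth] ..
  have conn: "connectedin riemann_sphere L"
    using connectedin_continuous_map_image[OF walsh_cont_K, of K] domain_connected walsh_bij
    by (simp add: connectedin_subtopology bij_betw_def)
  have inf: "None \<in> L" by (simp add: lemniscatic_domain_def)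
  have simple: "simple_path (c i)" for i
    unfolding c_def
  proof (rule simple_path_continuous_image[OF smooth_jordan_path(1)[OF domain_smooth]])
    show "continuous_on (path_image (\<lambda>x. \<eta> i (2 * pi * x))) \<phi>"
      "inj_on \<phi> (path_image (\<lambda>x. \<eta> i (2 * pi * x)))"
      unfolding smooth_jordan_path(3)[OF domain_smooth]
      by (rule continuous_on_subset[OF phi_continuous] inj_on_subset[OF phi_inj]; blast)+
  qed
  have loop: "pathfinish (c i) = pathstart (c i)" for i
    using smooth_jordan_path(2)[OF domain_smooth, of i] unfolding c_def pathfinish_compose pathstart_compose
    by (rule arg_cong)
  have off: "w \<notin> path_image (c i)" if "Some w \<in> L" for w i
    using that phi_notin_L unfolding im by blast
  have disj: "path_image (c i) \<inter> path_image (c j) = {}" if "i \<noteq> j" for i j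
  proof (rule ccontr)
    assume "path_image (c i) \<inter> path_image (c j) \<noteq> {}"
    then obtain x y where "x \<in> curve (\<eta> i)" "y \<in> curve (\<eta> j)" "\<phi> x = \<phi> y" unfolding im by blast
    moreover from this have "x = y" using phi_inj by (auto dest: inj_onD)
    ultimately show False using domain_disjoint[OF that] by blast
  qed
  have cl: "path_image (c i) \<subseteq> closure {w. Some w \<in> L}" for i
  proof -
    have "\<phi> ` closure K' \<subseteq> closure {w. Some w \<in> L}"
    proof (rule image_closure_subset)
      show "continuous_on (closure K') \<phi>" unfolding closure_K' by (rule phi_continuous)
      show "\<phi> ` K' \<subseteq> closure {w. Some w \<in> L}" using phi_in_L closure_subset[of "{w. Some w \<in> L}"] by auto
    qed simp
    then show ?thesis unfolding im closure_K' by blast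
  qed
  have ins: "a i \<in> inside (path_image (c i))" for i
  proof -
    have "{w. Some w \<in> \<Phi> ` Some ` curve (\<eta> i)} = \<phi> ` curve (\<eta> i)"
    proof (intro set_eqI iffI)
      fix w assume "w \<in> {w. Some w \<in> \<Phi> ` Some ` curve (\<eta> i)}"
      then obtain z where "z \<in> curve (\<eta> i)" "\<Phi> (Some z) = Some w" by force
      then show "w \<in> \<phi> ` curve (\<eta> i)" by force
    next
      fix w assume "w \<in> \<phi> ` curve (\<eta> i)"
      then obtain z where "z \<in> curve (\<eta> i)" "w = \<phi> z" by blast
      moreover from this have "\<Phi> (Some z) = Some w" using Phi_Some[of z] by blast
      ultimately show "w \<in> {w. Some w \<in> \<Phi> ` Some ` curve (\<eta> i)}" by force
    qed
    then show ?thesis using walsh_inside[of i] unfolding im by simp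
  qed
  note w = winding_number_disjoint_jordan[where c = c and \<beta> = a, OF conn inf simple loop off disj cl ins]
  show "winding_number (\<phi> \<circ> (\<lambda>x. \<eta> i (2 * pi * x))) (a i) \<in> {1, -1}"
    and "j \<noteq> i \<Longrightarrow> winding_number (\<phi> \<circ> (\<lambda>x. \<eta> i (2 * pi * x))) (a j) = 0"
    using w(1)[of i] w(2)[of j i] unfolding c_def by blast+
qed

section \<open>Normal form at infinity\<close>

text \<open>In the coordinate w = 1/z the map reads \<psi> w = w \<theta> w. The asymptotics give
  \<psi>' 0 = 1, so the factor \<theta> is analytic and nonzero at 0, and ln |\<phi>| there is -ln
  |w| plus a harmonic term.\<close>

lemma phi_at_infinity:
  obtains \<theta> where "\<theta> analytic_on {0}" "\<theta> 0 = 1"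
    "\<forall>\<^sub>F w in at 0. \<theta> w \<noteq> 0 \<and> \<phi> (inverse w) = inverse (w * \<theta> w)"
proof -
  define \<psi> where "\<psi> w = sphere_coord None (\<Phi> (sphere_chart None w))" for w
  have \<psi>: "\<psi> analytic_on {0}"
    using walsh_analytic[OF domain_infinity] unfolding \<psi>_def walsh_infinity .
  have \<psi>0: "\<psi> 0 = 0" by (simp add: \<psi>_def walsh_infinity)
  have "\<forall>\<^sub>F w in at 0. sphere_chart None w \<in> K"
    using eventually_chart_in_open[OF domain_open domain_infinity] by (simp add: eventually_nhds_conv_at)
  moreover have "\<forall>\<^sub>F w in at 0. w \<noteq> (0::complex)" by (simp add: eventually_at_filter)
  ultimately have \<psi>_eq: "\<forall>\<^sub>F w in at 0. w \<noteq> 0 \<and> \<psi> w = inverse (\<phi> (inverse w))"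
  proof eventually_elim
    case (elim w)
    then have "inverse w \<in> K'" by simp
    then have "\<Phi> (Some (inverse w)) = Some (\<phi> (inverse w))" by (intro Phi_Some) blast
    then have "sphere_coord None (\<Phi> (Some (inverse w))) = inverse (\<phi> (inverse w))"
      by (metis option.simps(5) sphere_coord.simps(2))
    then show ?case using elim by (simp add: \<psi>_def)
  qed
  \<comment> \<open>Equivalently \<phi> z / z tends to 1; inverting, \<psi> w / w tends to 1 at
    0.\<close>
  have "((\<lambda>z. (\<phi> z - z) / z) \<longlongrightarrow> 0) at_infinity"
  proof -
    obtain C where C: "\<forall>\<^sub>F z in at_infinity. cmod (\<phi> z - z) \<le> C * cmod (1 / z)"
      using landau_o.bigE[OF walsh_asymp] by blast
    have lim: "((\<lambda>z::complex. C * cmod (1 / z) * cmod (1 / z)) \<longlongrightarrow> C * cmod 0 * cmod 0) at_infinity"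
      by (intro tendsto_intros tendsto_divide_0[OF tendsto_const filterlim_ident])
    have "\<forall>\<^sub>F z in at_infinity. norm ((\<phi> z - z) / z) \<le> C * cmod (1 / z) * cmod (1 / z)"
      using C
    proof eventually_elim
      case (elim z)
      then show ?case
        using mult_right_mono[OF elim norm_ge_zero[of "1 / z"]] by (simp add: norm_divide)
    qed
    then show ?thesis by (rule Lim_null_comparison) (use lim in simp)
  qed
  then have "((\<lambda>z. (\<phi> z - z) / z + 1) \<longlongrightarrow> 0 + 1) at_infinity" by (intro tendsto_intros)
  then have "((\<lambda>w. (\<phi> (inverse w) - inverse w) / inverse w + 1) \<longlongrightarrow> 0 + 1) (at 0)"
    by (rule filterlim_compose) (rule filterlim_inverse_at_infinity)
  then have "((\<lambda>w. inverse ((\<phi> (inverse w) - inverse w) / inverse w + 1)) \<longlongrightarrow> inverse (0 + 1)) (at 0)"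
    by (rule tendsto_inverse) simp
  then have "((\<lambda>w. inverse ((\<phi> (inverse w) - inverse w) / inverse w + 1)) \<longlongrightarrow> 1) (at 0)"
    by simp
  then have "((\<lambda>w. \<psi> w / w) \<longlongrightarrow> 1) (at 0)"
  proof (rule Lim_transform_eventually)
    show "\<forall>\<^sub>F w in at 0. inverse ((\<phi> (inverse w) - inverse w) / inverse w + 1) = \<psi> w / w"
      using \<psi>_eq by eventually_elim (simp add: field_simps)
  qed
  then have "(\<psi> has_field_derivative 1) (at 0)"
    by (simp add: has_field_derivative_iff \<psi>0)
  then have d: "deriv \<psi> 0 = 1" by (rule DERIV_imp_deriv)
  \<comment> \<open>The value at 0 is the derivative of \<psi>, which removes the singularity of the
    quotient.\<close>
  define \<theta> where "\<theta> w = (if w = 0 then 1 else \<psi> w / w)" for w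
  have "\<theta> analytic_on {0}"
    using \<psi> by (rule pole_theorem_analytic_0[where a = 0])
      (auto simp: \<theta>_def d \<psi>0 intro: exI[of _ 1])
  moreover have "\<theta> 0 = 1" by (simp add: \<theta>_def)
  moreover have "\<forall>\<^sub>F w in at 0. \<theta> w \<noteq> 0"
  proof (rule tendsto_imp_eventually_ne)
    show "(\<theta> \<longlongrightarrow> \<theta> 0) (at 0)"
      using analytic_at_imp_isCont[OF calculation(1)] by (simp add: isCont_def)
  qed (simp add: \<theta>_def)
  with \<psi>_eq have "\<forall>\<^sub>F w in at 0. \<theta> w \<noteq> 0 \<and> \<phi> (inverse w) = inverse (w * \<theta> w)"
    by eventually_elim (simp add: \<theta>_def)
  ultimately show ?thesis using that by blast
qed

section \<open>The potential attached to a vector of coefficients\<close>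

context
  fixes \<alpha> :: "'l \<Rightarrow> complex" and f :: "'l \<Rightarrow> complex option \<Rightarrow> complex"
    and h :: "'l \<Rightarrow> 'l \<Rightarrow> real"
  assumes \<alpha>: "\<And>j. \<alpha> j \<in> inside (curve (\<eta> j))"
    and f: "\<And>j. sphere_analytic_on (f j) K" and f_infinity: "\<And>j. f j None = 0"
    and f_boundary: "\<And>j k t. t \<in> {0..2*pi} \<Longrightarrow>
      ((\<lambda>z. Re (f j (Some z))) \<longlongrightarrow> h k j - ln (cmod (\<eta> k t - \<alpha> j))) (at (\<eta> k t) within K')"
begin

lemma f_holomorphic: "(\<lambda>z. f j (Some z)) holomorphic_on K'"
proof -
  have "(\<lambda>z. f j (Some z)) analytic_on {z}" if z: "z \<in> K'" for z
  proof -
    have "(\<lambda>w. f j (Some (z + w))) analytic_on {0}"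
      using f[of j] z by (force simp: sphere_analytic_on_def)
    then have "(\<lambda>w. f j (Some (z + w))) analytic_on (\<lambda>x. x - z) ` {z}" by simp
    then have "(\<lambda>w. f j (Some (z + w))) \<circ> (\<lambda>x. x - z) analytic_on {z}"
      by (rule analytic_on_compose[rotated]) (intro analytic_intros)
    then show ?thesis by (simp add: o_def)
  qed
  then have "(\<lambda>z. f j (Some z)) analytic_on K'" by (subst analytic_on_analytic_at) blast
  then show ?thesis by (rule analytic_imp_holomorphic)
qed

text \<open>The value \<open>0\<close> at infinity is the limit of the values at finite points if \<open>\<Sum>\<^sub>j n\<^sub>j = s\<close>.\<close>

definition potential :: "('l \<Rightarrow> real) \<Rightarrow> real \<Rightarrow> complex option \<Rightarrow> real" where
  "potential n s q = (case q of None \<Rightarrow> 0 | Some z \<Rightarrow>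
     s * (\<Sum>j\<in>UNIV. m j * ln (cmod (\<phi> z - a j))) -
     (\<Sum>j\<in>UNIV. n j * (Re (f j (Some z)) + ln (cmod (z - \<alpha> j)))))"

lemma potential_harmonic_finite:
  assumes "z \<in> K'"
  shows "harmonic_germ (\<lambda>w. potential n s (Some (z + w)))"
proof -
  have trans: "(\<lambda>w. g (z + w)) analytic_on {0}" if "g holomorphic_on K'" for g
  proof -
    have "g analytic_on (\<lambda>w. z + w) ` {0}"
      using that open_K' assms analytic_on_subset[of g K'] by (simp add: analytic_on_open)
    then have "g \<circ> (\<lambda>w. z + w) analytic_on {0}"
      by (rule analytic_on_compose[rotated]) (intro analytic_intros)
    then show ?thesis by (simp add: o_def)
  qed
  have 1: "harmonic_germ (\<lambda>w. ln (cmod (\<phi> (z + w) - a j)))" for j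
    using phi_ne_centre[OF assms, of j]
    by (intro harmonic_germ_ln_cmod analytic_on_diff trans[OF phi_holomorphic] analytic_on_const) simp
  have 2: "harmonic_germ (\<lambda>w. Re (f j (Some (z + w))))" for j
    by (intro harmonic_germ_Re trans[OF f_holomorphic])
  have "z \<noteq> \<alpha> j" for j using curve_windings(4)[OF \<alpha>, of j] assms by blast
  then have 3: "harmonic_germ (\<lambda>w. ln (cmod (z + w - \<alpha> j)))" for j
    by (intro harmonic_germ_ln_cmod analytic_intros) simp
  show ?thesis unfolding potential_def option.case
    by (intro harmonic_germ_diff harmonic_germ_cmult harmonic_germ_sum harmonic_germ_add 1 2 3 finite)
qed

text \<open>Every logarithm splits off -ln |w|. The total coefficients are s times the sum of the m,
  that is s, and the sum of the n, also s, so the singular terms cancel and \<open>?v\<close>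
  remains.\<close>

lemma potential_harmonic_infinity:
  assumes n: "(\<Sum>j\<in>UNIV. n j) = s"
  shows "harmonic_germ (\<lambda>w. potential n s (sphere_chart None w))"
proof -
  obtain \<theta> where \<theta>: "\<theta> analytic_on {0}" "\<theta> 0 = 1"
    "\<forall>\<^sub>F w in at 0. \<theta> w \<noteq> 0 \<and> \<phi> (inverse w) = inverse (w * \<theta> w)"
    using phi_at_infinity .
  let ?v = "\<lambda>w. s * (\<Sum>j\<in>UNIV. m j * ln (cmod (1 - a j * (w * \<theta> w)))) - s * ln (cmod (\<theta> w)) -
    (\<Sum>j\<in>UNIV. n j * (Re (f j (sphere_chart None w)) + ln (cmod (1 - \<alpha> j * w))))"
  have an: "(\<lambda>w. 1 - a j * (w * \<theta> w)) analytic_on {0}" "(\<lambda>w. 1 - \<alpha> j * w) analytic_on {0}" for j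
    using \<theta>(1) by (intro analytic_intros; simp)+
  have "(\<lambda>w. f j (sphere_chart None w)) analytic_on {0}" for j
    using f[of j] domain_infinity unfolding sphere_analytic_on_def by blast
  then have "harmonic_germ ?v"
    by (intro harmonic_germ_diff harmonic_germ_cmult harmonic_germ_sum harmonic_germ_add
        harmonic_germ_ln_cmod harmonic_germ_Re an \<theta>(1) finite) (simp_all add: \<theta>(2))
  moreover have "\<forall>\<^sub>F w in nhds 0. potential n s (sphere_chart None w) = ?v w"
  proof -
    have nz: "\<forall>\<^sub>F w in at 0. g w \<noteq> 0" if "g analytic_on {0}" "g 0 \<noteq> 0" for g :: "complex \<Rightarrow> complex"
      using analytic_at_imp_isCont[OF that(1)] that(2)
      by (intro tendsto_imp_eventually_ne[of g "g 0"]) (simp_all add: isCont_def)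
    have "\<forall>\<^sub>F w in at 0. \<forall>j. 1 - a j * (w * \<theta> w) \<noteq> 0 \<and> 1 - \<alpha> j * w \<noteq> 0"
      by (intro eventually_all_finite eventually_conj nz an) simp_all
    moreover have "\<forall>\<^sub>F w in at 0. w \<noteq> (0::complex)" by (simp add: eventually_at_filter)
    ultimately have "\<forall>\<^sub>F w in at 0. potential n s (sphere_chart None w) = ?v w"
      using \<theta>(3)
    proof eventually_elim
      case (elim w)
      then have w: "w \<noteq> 0" "\<theta> w \<noteq> 0" "\<phi> (inverse w) = inverse (w * \<theta> w)"
        and nz: "1 - a j * (w * \<theta> w) \<noteq> 0" "1 - \<alpha> j * w \<noteq> 0" for j by auto
      have "\<phi> (inverse w) - a j = (1 - a j * (w * \<theta> w)) / (w * \<theta> w)" for j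
        using w by (simp add: field_simps)
      then have 1: "ln (cmod (\<phi> (inverse w) - a j)) =
          ln (cmod (1 - a j * (w * \<theta> w))) - (ln (cmod w) + ln (cmod (\<theta> w)))" for j
        using w nz(1)[of j] by (simp add: norm_divide norm_mult ln_div ln_mult)
      have "inverse w - \<alpha> j = (1 - \<alpha> j * w) / w" for j
        using w by (simp add: field_simps)
      then have 2: "ln (cmod (inverse w - \<alpha> j)) = ln (cmod (1 - \<alpha> j * w)) - ln (cmod w)" for j
        using w nz(2)[of j] by (simp add: norm_divide ln_div)
      have "potential n s (sphere_chart None w) =
          s * (\<Sum>j\<in>UNIV. m j * (ln (cmod (1 - a j * (w * \<theta> w))) - (ln (cmod w) + ln (cmod (\<theta> w))))) -
          (\<Sum>j\<in>UNIV. n j * (Re (f j (Some (inverse w))) + (ln (cmod (1 - \<alpha> j * w)) - ln (cmod w))))"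
        using w(1) unfolding potential_def by (simp add: 1 2)
      also have "\<dots> = s * ((\<Sum>j\<in>UNIV. m j * ln (cmod (1 - a j * (w * \<theta> w)))) -
            (\<Sum>j\<in>UNIV. m j) * (ln (cmod w) + ln (cmod (\<theta> w)))) -
          ((\<Sum>j\<in>UNIV. n j * (Re (f j (Some (inverse w))) + ln (cmod (1 - \<alpha> j * w)))) -
            (\<Sum>j\<in>UNIV. n j) * ln (cmod w))"
        by (simp only: sum_distrib_right right_diff_distrib add_diff_eq sum_subtractf)
      also have "\<dots> = ?v w" using w(1) by (simp add: walsh_sum n algebra_simps)
      finally show ?case .
    qed
    \<comment> \<open>The prescribed value 0 at infinity fits, because \<theta> is 1 there and each
      f vanishes.\<close>
    moreover have "potential n s (sphere_chart None 0) = ?v 0"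
      by (simp add: potential_def \<theta>(2) f_infinity)
    ultimately show ?thesis by (simp add: eventually_nhds_conv_at)
  qed
  ultimately show ?thesis by (rule harmonic_germ_cong)
qed

text \<open>On the boundary the logarithm in the limit of Re f cancels ln |z - \<alpha>|, which
  leaves the constants h; their weighted sum is c on every curve.\<close>

lemma potential_boundary:
  assumes c: "\<And>k. (\<Sum>j\<in>UNIV. h k j * n j) = c" and z: "z \<in> \<Gamma>"
  shows "((\<lambda>x. potential n s (Some x)) \<longlongrightarrow> s * ln \<tau> - c) (at z within K')"
proof -
  obtain k t where t: "t \<in> {0..2*pi}" "z = \<eta> k t" using z by (auto simp: curve_def)
  have "(\<phi> \<longlongrightarrow> \<phi> z) (at z within K')"
    using phi_continuous z unfolding continuous_on by (meson UnI2 sup_ge1 tendsto_within_subset)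
  then have 1: "((\<lambda>x. ln (cmod (\<phi> x - a j))) \<longlongrightarrow> ln (cmod (\<phi> z - a j))) (at z within K')" for j
    using phi_boundary(2)[OF z, of j] by (intro tendsto_intros) simp_all
  have "z \<noteq> \<alpha> j" for j using curve_windings(3)[OF \<alpha>, of j] z by blast
  then have 2: "((\<lambda>x. ln (cmod (x - \<alpha> j))) \<longlongrightarrow> ln (cmod (z - \<alpha> j))) (at z within K')" for j
    by (intro tendsto_intros) simp_all
  have "((\<lambda>x. potential n s (Some x)) \<longlongrightarrow>
      s * (\<Sum>j\<in>UNIV. m j * ln (cmod (\<phi> z - a j))) -
      (\<Sum>j\<in>UNIV. n j * ((h k j - ln (cmod (z - \<alpha> j))) + ln (cmod (z - \<alpha> j))))) (at z within K')"
    unfolding potential_def option.case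
    by (intro tendsto_diff tendsto_mult tendsto_sum tendsto_add tendsto_const 1 2)
      (use f_boundary t in blast)
  also have "s * (\<Sum>j\<in>UNIV. m j * ln (cmod (\<phi> z - a j))) -
      (\<Sum>j\<in>UNIV. n j * ((h k j - ln (cmod (z - \<alpha> j))) + ln (cmod (z - \<alpha> j)))) = s * ln \<tau> - c"
    using c[of k] by (simp add: phi_boundary(1)[OF z] mult.commute)
  finally show ?thesis .
qed

text \<open>The maximum principle for the potential and for its negative makes it constantly s ln
  \<tau> - c, and the value at infinity is 0.\<close>

lemma potential_zero:
  assumes n: "(\<Sum>j\<in>UNIV. n j) = s" and c: "\<And>k. (\<Sum>j\<in>UNIV. h k j * n j) = c"
  shows "c = s * ln \<tau>" and "q \<in> K \<Longrightarrow> potential n s q = 0"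
proof -
  let ?b = "s * ln \<tau> - c"
  have harm: "harmonic_germ (\<lambda>w. potential n s (sphere_chart p w))" if "p \<in> K" for p
    using that potential_harmonic_finite potential_harmonic_infinity[OF n] by (cases p) auto
  have bd: "\<exists>N. openin riemann_sphere N \<and> p \<in> N \<and> (\<forall>q\<in>N \<inter> K. \<bar>potential n s q - ?b\<bar> < e)"
    if p: "p \<in> riemann_sphere frontier_of K" and "e > 0" for p e
  proof -
    obtain z where z: "p = Some z" "z \<in> \<Gamma>" using p unfolding domain_frontier by blast
    \<comment> \<open>The limit is punctured, but z itself is not in K, so a full neighbourhood on
      the sphere results.\<close>
    have "\<forall>\<^sub>F x in at z within K'. dist (potential n s (Some x)) ?b < e"
      using potential_boundary[OF c z(2)] \<open>e > 0\<close> by (rule tendstoD)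
    then obtain T where T: "open T" "z \<in> T"
      "\<And>x. x \<in> T \<Longrightarrow> x \<noteq> z \<Longrightarrow> x \<in> K' \<Longrightarrow> dist (potential n s (Some x)) ?b < e"
      unfolding eventually_at_topological by blast
    have "\<bar>potential n s q - ?b\<bar> < e" if q: "q \<in> Some ` T \<inter> K" for q
    proof -
      obtain x where x: "q = Some x" "x \<in> T" "x \<in> K'" using q by blast
      moreover have "x \<noteq> z" using x(3) curves_disjoint_K[OF z(2)] by blast
      ultimately show ?thesis using T(3)[of x] by (simp add: dist_real_def)
    qed
    moreover have "openin riemann_sphere (Some ` T)" using T(1) openin_riemann_sphere_Some by blast
    ultimately show ?thesis using T(2) z(1) by blast
  qed
  have fr: "riemann_sphere frontier_of K \<noteq> {}"
    unfolding domain_frontier using in_curve[OF domain_smooth] by blast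
  have "potential n s q \<le> ?b" if "q \<in> K" for q
    using domain_open domain_connected fr harm bd that by (rule sphere_harmonic_le_boundary)
  moreover have "- potential n s q \<le> - ?b" if "q \<in> K" for q
    using domain_open domain_connected fr
  proof (rule sphere_harmonic_le_boundary[where U = "\<lambda>q. - potential n s q"])
    show "harmonic_germ (\<lambda>w. - potential n s (sphere_chart p w))" if "p \<in> K" for p
      using harmonic_germ_cmult[OF harm[OF that], of "-1"] by simp
    show "\<exists>N. openin riemann_sphere N \<and> p \<in> N \<and> (\<forall>q\<in>N \<inter> K. \<bar>- potential n s q - - ?b\<bar> < e)"
      if "p \<in> riemann_sphere frontier_of K" "e > 0" for p e
      using bd[OF that] unfolding minus_diff_minus abs_minus_cancel .
  qed (rule that)
  ultimately have const: "potential n s q = ?b" if "q \<in> K" for q using that by force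
  moreover have "potential n s None = 0" by (simp add: potential_def)
  ultimately have "?b = 0" using domain_infinity by metis
  then show "c = s * ln \<tau>" "q \<in> K \<Longrightarrow> potential n s q = 0" using const by simp_all
qed

text \<open>Along the pushed-off loop the vanishing potential equates two weighted sums of winding
  numbers. By homotopy these are the winding numbers of the boundary curve and of its image, so only
  the terms with index i survive, each with a factor 1 or -1.\<close>

lemma system_solution_up_to_sign:
  assumes n: "(\<Sum>j\<in>UNIV. n j) = s" and c: "\<And>k. (\<Sum>j\<in>UNIV. h k j * n j) = c"
  shows "n i = s * m i \<or> n i = - (s * m i)"
proof -
  let ?p = "\<lambda>x. \<eta> i (2 * pi * x)"
  obtain \<sigma> where \<sigma>: "valid_path \<sigma>" "pathfinish \<sigma> = pathstart \<sigma>" "path_image \<sigma> \<subseteq> K'"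
    and hom: "homotopic_loops (K' \<union> curve (\<eta> i)) ?p \<sigma>"
    using push_off_loop[OF sbd] .
  have \<alpha>K: "\<alpha> j \<notin> K' \<union> curve (\<eta> i)" for j
    using curve_windings(3,4)[OF \<alpha>] by blast
  have w\<alpha>: "winding_number \<sigma> (\<alpha> j) = winding_number ?p (\<alpha> j)" for j
    using \<alpha>K[of j] by (intro winding_number_homotopic_loops[symmetric] homotopic_loops_subset[OF hom]) blast
  \<comment> \<open>The homotopy is carried over by \<phi>, which is continuous up to the curve and
    avoids the centres there as well.\<close>
  have wa: "winding_number (\<phi> \<circ> \<sigma>) (a j) = winding_number (\<phi> \<circ> ?p) (a j)" for j
  proof (intro winding_number_homotopic_loops[symmetric] homotopic_loops_continuous_image[OF hom])
    show "continuous_on (K' \<union> curve (\<eta> i)) \<phi>"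
      by (rule continuous_on_subset[OF phi_continuous]) blast
    show "\<phi> \<in> K' \<union> curve (\<eta> i) \<rightarrow> - {a j}"
    proof (rule funcsetI)
      fix x assume "x \<in> K' \<union> curve (\<eta> i)"
      then have "x \<in> K' \<or> x \<in> \<Gamma>" by blast
      then have "\<phi> x \<noteq> a j" using phi_ne_centre[of x j] phi_boundary(2)[of x j] by blast
      then show "\<phi> x \<in> - {a j}" by simp
    qed
  qed
  have "(\<Sum>j\<in>UNIV. (s * m j) * winding_number (\<phi> \<circ> \<sigma>) (a j)) = (\<Sum>j\<in>UNIV. n j * winding_number \<sigma> (\<alpha> j))"
  proof (rule log_potential_winding[OF open_K' phi_holomorphic f_holomorphic _ _ _ \<sigma>(1,3,2)])
    show "\<phi> z \<noteq> a j" if "z \<in> K'" for z j using phi_ne_centre[OF that] .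
    show "\<alpha> j \<notin> K'" for j using \<alpha>K by blast
    fix z assume "z \<in> K'"
    then have "potential n s (Some z) = 0" using potential_zero(2)[OF n c] by blast
    then show "(\<Sum>j\<in>UNIV. (s * m j) * ln (cmod (\<phi> z - a j))) -
        (\<Sum>j\<in>UNIV. n j * (Re (f j (Some z)) + ln (cmod (z - \<alpha> j)))) = 0"
      by (simp add: potential_def sum_distrib_left mult.assoc)
  qed
  moreover have "(\<Sum>j\<in>UNIV. (s * m j) * winding_number (\<phi> \<circ> \<sigma>) (a j)) =
      (s * m i) * winding_number (\<phi> \<circ> ?p) (a i)"
    unfolding wa by (subst sum.remove[of _ i]) (simp_all add: image_curve_windings(2) del: o_apply)
  moreover have "(\<Sum>j\<in>UNIV. n j * winding_number \<sigma> (\<alpha> j)) = n i * winding_number ?p (\<alpha> i)"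
    unfolding w\<alpha> by (subst sum.remove[of _ i]) (simp_all add: curve_windings(2)[OF \<alpha>])
  ultimately have "complex_of_real (s * m i) * winding_number (\<phi> \<circ> ?p) (a i) =
      complex_of_real (n i) * winding_number ?p (\<alpha> i)" by metis
  moreover have "winding_number (\<phi> \<circ> ?p) (a i) = 1 \<or> winding_number (\<phi> \<circ> ?p) (a i) = -1"
    using image_curve_windings(1)[of i] by blast
  moreover have "winding_number ?p (\<alpha> i) = 1 \<or> winding_number ?p (\<alpha> i) = -1"
    using curve_windings(1)[OF \<alpha>, of i] by blast
  ultimately have "complex_of_real (n i) = of_real (s * m i) \<or> complex_of_real (n i) = of_real (- (s * m i))"
    by (elim disjE) (simp_all del: of_real_mult o_apply)
  then show ?thesis unfolding of_real_eq_iff .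
qed

end

end

section \<open>The linear system\<close>

lemma system_matrix_mult:
  fixes h :: "'l::finite \<Rightarrow> 'l \<Rightarrow> real"
  shows "system_matrix h *v x = (\<chi> r. case r of Some k \<Rightarrow> (\<Sum>j\<in>UNIV. h k j * x $ Some j) - x $ None
     | None \<Rightarrow> (\<Sum>j\<in>UNIV. x $ Some j))"
proof -
  have sum_option: "(\<Sum>c\<in>UNIV. g c) = g None + (\<Sum>j\<in>UNIV. g (Some j))"
    for g :: "'l option \<Rightarrow> real"
    by (simp add: UNIV_option_conv sum.reindex)
  show ?thesis
    by (simp add: vec_eq_iff matrix_vector_mult_def system_matrix_def sum_option split: option.split)
qed

theorem theorem4p3:
  fixes K :: "complex option set"
    and \<eta> :: "'l::finite \<Rightarrow> real \<Rightarrow> complex"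
    and a \<alpha> :: "'l \<Rightarrow> complex"
    and m :: "'l \<Rightarrow> real" and \<tau> :: real
    and \<Phi> :: "complex option \<Rightarrow> complex option"
    and \<gamma> \<mu> :: "'l \<Rightarrow> 'l \<Rightarrow> real \<Rightarrow> real"
    and h :: "'l \<Rightarrow> 'l \<Rightarrow> real"
    and f :: "'l \<Rightarrow> complex option \<Rightarrow> complex"
  assumes "smoothly_bounded_domain K \<eta>"
    and "walsh_map K \<eta> a m \<tau> \<Phi>"
    and "\<And>j. \<alpha> j \<in> inside (curve (\<eta> j))"
    and "\<And>j k t. \<gamma> j k t = - ln (cmod (\<eta> k t - \<alpha> j))"
    and "\<And>j. associated_functions K \<eta> (\<gamma> j) (\<mu> j) (\<lambda>k. h k j) (f j)"
  shows "system_matrix h *v append_last m (ln \<tau>) = append_last (\<lambda>_. 0) 1 \<and>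
    (\<forall>x. system_matrix h *v x = append_last (\<lambda>_. 0) 1 \<longrightarrow> x = append_last m (ln \<tau>))"
proof -
  interpret walsh_setting K \<eta> a m \<tau> \<Phi>
    by unfold_locales (fact assms)+
  have f: "sphere_analytic_on (f j) K" "f j None = 0" for j
    using assms(5)[of j] by (simp_all add: associated_functions_def)
  have f_boundary: "((\<lambda>z. Re (f j (Some z))) \<longlongrightarrow> h k j - ln (cmod (\<eta> k t - \<alpha> j)))
      (at (\<eta> k t) within {z. Some z \<in> K})" if "t \<in> {0..2*pi}" for j k t
  proof -
    have "((\<lambda>z. f j (Some z)) \<longlongrightarrow> of_real (\<gamma> j k t + h k j) + \<i> * of_real (\<mu> j k t))
        (at (\<eta> k t) within {z. Some z \<in> K})"
      using assms(5)[of j] that unfolding associated_functions_def by blast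
    then have "((\<lambda>z. Re (f j (Some z))) \<longlongrightarrow> Re (of_real (\<gamma> j k t + h k j) + \<i> * of_real (\<mu> j k t)))
        (at (\<eta> k t) within {z. Some z \<in> K})" by (rule tendsto_Re)
    then show ?thesis by (simp add: assms(4))
  qed
  let ?A = "system_matrix h"
  \<comment> \<open>The last entry s of the right-hand side is kept general: s = 1 is the given
    system, s = 0 the homogeneous one. The last unknown takes the part of c.\<close>
  have rows: "(\<Sum>j\<in>UNIV. x $ Some j) = s" "\<And>k. (\<Sum>j\<in>UNIV. h k j * x $ Some j) = x $ None"
    if "?A *v x = append_last (\<lambda>_. 0) s" for x s
  proof -
    have "(?A *v x) $ r = append_last (\<lambda>_. 0) s $ r" for r using that by simp
    from this[of None] this[of "Some k" for k]
    show "(\<Sum>j\<in>UNIV. x $ Some j) = s" "\<And>k. (\<Sum>j\<in>UNIV. h k j * x $ Some j) = x $ None"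
      by (simp_all add: system_matrix_mult append_last_def)
  qed
  have sign: "x $ Some i = s * m i \<or> x $ Some i = - (s * m i)" and last: "x $ None = s * ln \<tau>"
    if "?A *v x = append_last (\<lambda>_. 0) s" for x s i
    using system_solution_up_to_sign[of \<alpha> f h, OF assms(3) f f_boundary rows[OF that]]
      potential_zero(1)[of \<alpha> f h, OF assms(3) f f_boundary rows[OF that]] by blast+
  have unique: "x = append_last m (ln \<tau>)" if x: "?A *v x = append_last (\<lambda>_. 0) 1" for x
  proof -
    \<comment> \<open>Either sign gives at most m j, since m j > 0. The nonnegative differences sum
      to 1 - 1 = 0, so the minus sign never occurs.\<close>
    have "0 \<le> m j - x $ Some j" for j
      using sign[OF x, of j] walsh_pos[of j] by auto
    moreover have "(\<Sum>j\<in>UNIV. m j - x $ Some j) = 0"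
      using rows(1)[OF x] walsh_sum by (simp add: sum_subtractf)
    ultimately have "m j - x $ Some j = 0" for j
      using sum_nonneg_eq_0_iff[of UNIV "\<lambda>j. m j - x $ Some j"] by simp
    then show ?thesis
      using last[OF x] by (simp add: vec_eq_iff append_last_def split: option.split)
  qed
  \<comment> \<open>For s = 0 both signs give 0, so the kernel is trivial. The matrix is square,
    hence surjective, and the solution so obtained is the claimed vector by uniqueness.\<close>
  have "x = 0" if "?A *v x = 0" for x
  proof -
    have "?A *v x = append_last (\<lambda>_. 0) 0"
      unfolding that by (simp add: vec_eq_iff append_last_def split: option.split)
    then have "x $ r = 0" for r
      using sign[of x 0] last[of x 0] by (cases r) auto
    then show ?thesis by (simp add: vec_eq_iff)
  qed
  then have "inj ((*v) ?A)"
    by (simp add: linear_injective_0[OF matrix_vector_mul_linear])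
  then have "surj ((*v) ?A)"
    by (rule linear_injective_imp_surjective[OF matrix_vector_mul_linear]) simp
  then obtain x where "?A *v x = append_last (\<lambda>_. 0) 1" by (metis surjD)
  then show ?thesis using unique by metis
qed

end
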